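(* The following inequalities hold. (i) For $0<x<y$, $$\bigg(\frac{x}{y}\bigg)^{\mu-\nu+1}\bigg(\frac{(\mu+3)^2-\nu^2+y^2}{(\mu+3)^2-\nu^2+x^2}\bigg)^{\frac{\mu-\nu+1}{2}}\frac{I_\nu(x)}{I_\nu(y)}<\frac{\tilde{t}_{\mu,\nu}(x)}{\tilde{t}_{\mu,\nu}(y)}<\frac{I_\nu(x)}{I_\nu(y)},$$ where the lower bound holds for $\mu>-2$, $-1\leq\nu<\mu+1$ and the upper bound holds for $\mu>-1$, $0\leq\nu<\mu+1$. (ii) For $0<x<y$, $$\frac{\tilde{t}_{\mu,\nu}(x)}{\tilde{t}_{\mu,\nu}(y)}>\frac{\mathrm{e}^{\sqrt{(\nu+1/2)^2+x^2}}}{\mathrm{e}^{\sqrt{(\nu+1/2)^2+y^2}}}\bigg(\frac{x}{y}\bigg)^{\mu+1}\bigg(\frac{(\mu+3)^2-\nu^2+y^2}{(\mu+3)^2-\nu^2+x^2}\bigg)^{\frac{\mu-\nu+1}{2}}\Bigg(\frac{\nu+\frac{1}{2}+\sqrt{(\nu+\frac{1}{2})^2+y^2}}{\nu+\frac{1}{2}+\sqrt{(\nu+\frac{1}{2})^2+x^2}}\Bigg)^{\nu+\frac{1}{2}}$$ for $\mu>-\frac{3}{2}$, $-\frac{1}{2}\leq\nu<\mu+1$, and $$\frac{\tilde{t}_{\mu,\nu}(x)}{\tilde{t}_{\mu,\nu}(y)}<\frac{\mathrm{e}^{\sqrt{(\nu+3/2)^2+x^2}}}{\mathrm{e}^{\sqrt{(\nu+3/2)^2+y^2}}}\bigg(\frac{\tanh\big(\frac{1}{2}x\big)}{\tanh\big(\frac{1}{2}y\big)}\bigg)^{\mu-\nu+1}\bigg(\frac{x}{y}\bigg)^{\nu}\Bigg(\frac{\mu+\frac{3}{2}+\sqrt{(\nu+\frac{3}{2})^2+y^2}}{\mu+\frac{3}{2}+\sqrt{(\nu+\frac{3}{2})^2+x^2}}\Bigg)^{\mu+\frac{3}{2}}$$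 for $\mu\geq-\frac{1}{2}$, $-1\leq\nu<\mu+1$, $(\mu+3)^2-\nu^2\geq6$. (iii) For $x>0$, $\mu>-2$ and $-1<\nu<\mu+1$, $$I_\nu(x)<\bigg(\frac{x^2}{(\mu+3)^2-\nu^2+x^2}\bigg)^{-\frac{\mu-\nu+1}{2}}\tilde{t}_{\mu,\nu}(x)<C_{\mu,\nu}I_\nu(x),$$ where $$C_{\mu,\nu}=\frac{\big((\mu+3)^2-\nu^2\big)^{\frac{\mu-\nu+1}{2}}\Gamma(\nu+1)}{2^{\mu-\nu+1}\Gamma\big(\frac{\mu-\nu+3}{2}\big)\Gamma\big(\frac{\mu+\nu+3}{2}\big)}.$$ Also, $\tilde{t}_{\mu,\nu}(x)<I_\nu(x)$ for $x>0$, $\mu>-1$, $0\leq\nu<\mu+1$. (iv) Let $\mu>-\frac{3}{2}$, $-\frac{1}{2}\leq\nu<\mu+1$. Then, for $x>0$, $$\frac{1}{\sqrt{2\pi}}<\frac{\big((\mu+3)^2-\nu^2+x^2\big)^{\frac{\mu-\nu+1}{2}}\Big(\nu+\frac{1}{2}+\sqrt{\big(\nu+\frac{1}{2}\big)^2+x^2}\Big)^{\nu+\frac{1}{2}}}{x^{\mu+1}\mathrm{e}^{\sqrt{(\nu+1/2)^2+x^2}}}\,\tilde{t}_{\mu,\nu}(x)<C_{\mu,\nu}',$$ where $$C_{\mu,\nu}'=\frac{\big((\mu+3)^2-\nu^2\big)^{\frac{\mu-\nu+1}{2}}\big(\mathrm{e}^{-1}(2\nu+1)\big)^{\nu+\f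rac{1}{2}}}{2^{\mu+1}\Gamma\big(\frac{\mu-\nu+3}{2}\big)\Gamma\big(\frac{\mu+\nu+3}{2}\big)}.$$
   Context: For real $\mu,\nu$ and $x>0$, the (normalized) modified Lommel function of the first kind is $$\tilde{t}_{\mu,\nu}(x)=\sum_{k=0}^\infty\frac{(\frac{1}{2}x)^{\mu+2k+1}}{\Gamma\big(k+\frac{\mu-\nu+3}{2}\big)\Gamma\big(k+\frac{\mu+\nu+3}{2}\big)},$$ and the modified Bessel function of the first kind is $$I_\nu(x)=\sum_{k=0}^\infty\frac{(\frac{1}{2}x)^{2k+\nu}}{k!\,\Gamma(k+\nu+1)},$$ where $1/\Gamma(z)$ is interpreted as $0$ for $z=0,-1,-2,\ldots$. The convention $0^0=1$ is used (relevant for $C'_{\mu,\nu}$ when $\nu=-\frac12$). *)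

theory Defs
  imports "HOL-Analysis.Analysis"
begin

text \<open>
  \<^const>\<open>rGamma\<close> is the reciprocal Gamma function and vanishes at the nonpositive integers, so it
  implements the convention that $1/\Gamma(z)$ is read as $0$ there.
\<close>

definition modified_Lommel_t :: "real \<Rightarrow> real \<Rightarrow> real \<Rightarrow> real" where
  "modified_Lommel_t \<mu> \<nu> x =
     (\<Sum>k. (x / 2) powr (\<mu> + 2 * real k + 1) *
           rGamma (real k + (\<mu> - \<nu> + 3) / 2) * rGamma (real k + (\<mu> + \<nu> + 3) / 2))"

definition modified_Bessel_I :: "real \<Rightarrow> real \<Rightarrow> real" where
  "modified_Bessel_I \<nu> x =
     (\<Sum>k. (x / 2) powr (2 * real k + \<nu>) / fact k * rGamma (real k + \<nu> + 1))"

text \<open>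
  In HOL \<^term>\<open>(0::real) powr 0\<close> is $0$; this variant follows the convention $0^0 = 1$.
\<close>

definition rpow :: "real \<Rightarrow> real \<Rightarrow> real" where
  "rpow b a = (if b = 0 \<and> a = 0 then 1 else b powr a)"

definition Lommel_C :: "real \<Rightarrow> real \<Rightarrow> real" where
  "Lommel_C \<mu> \<nu> =
     ((\<mu> + 3)\<^sup>2 - \<nu>\<^sup>2) powr ((\<mu> - \<nu> + 1) / 2) * Gamma (\<nu> + 1) /
     (2 powr (\<mu> - \<nu> + 1) * Gamma ((\<mu> - \<nu> + 3) / 2) * Gamma ((\<mu> + \<nu> + 3) / 2))"

text \<open>The base $e^{-1}(2\nu+1)$ and its exponent both vanish at $\nu = -1/2$.\<close>

definition Lommel_C' :: "real \<Rightarrow> real \<Rightarrow> real" where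
  "Lommel_C' \<mu> \<nu> =
     ((\<mu> + 3)\<^sup>2 - \<nu>\<^sup>2) powr ((\<mu> - \<nu> + 1) / 2) * rpow (exp (- 1) * (2 * \<nu> + 1)) (\<nu> + 1 / 2) /
     (2 powr (\<mu> + 1) * Gamma ((\<mu> - \<nu> + 3) / 2) * Gamma ((\<mu> + \<nu> + 3) / 2))"

end

theory Submission
  imports Defs "HOL-Real_Asymp.Real_Asymp"
begin

text \<open>
  Both functions are instances of $F(a, b; x) = \sum_{k \ge 0} (x/2)^{a + b - 2 + 2k} / (\Gamma(k + a) \Gamma(k + b))$,
  namely $t = F(a, b)$ with $a = (\mu - \nu + 3)/2$, $b = (\mu + \nu + 3)/2$, and $I_\nu = F(1, \nu + 1)$;
  moreover $a b = ((\mu + 3)^2 - \nu^2)/4$. Every inequality between quotients says that a product of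
  explicit functions with $t$ or $I_\nu$ is monotone, and every inequality with a constant
  compares such a product with its limit at $0$ or at $\infty$. Monotonicity is a bound for
  the logarithmic derivative
  $t'/t = \nu/x + F(a, b + 1)/F(a, b) + (2(a - 1)/x) \cdot (\mbox{first term of } t)/t$. Comparisons with $I_\nu$
  follow from first-order equations for Wronskian-like combinations, the explicit ones from a Riccati
  comparison, and the first term is estimated termwise. For the limits at infinity, log-convexity
  of $\Gamma$ shows that $F(a, b)$ and $F(a, b + \delta)$ are asymptotically equal, so that all $F(a, b)$
  behave like $F(1, 1/2; x) = \sqrt{2/(\pi x)} \cosh x$.
\<close>

section \<open>The common series\<close>

text \<open>In the parameters a, b both Gamma factors play the same role, and differentiation lowers
  either one by 1. The first-order equations for t then differ from those for I_\<nu> only by the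
  first term of the series, which carries the factor a - 1; this factor vanishes for a = 1, the
  Bessel case. So everything hinges on the share of the first term in t, and its two estimates shape
  the statement. Keeping the terms k = 0 and k = 1 bounds the share above by A/(A + x^2) with A =
  4ab, and A/(x(A + x^2)) is half the logarithmic derivative of x^2/(A + x^2). Comparing
  coefficients with sinh bounds it below by x/sinh x, and 1/sinh x is the logarithmic derivative of
  tanh(x/2); the conditions \<mu> \<ge> -1/2 and (\<mu> + 3)^2 - \<nu>^2 \<ge> 6 are what this
  comparison asks for. The square roots come from explicit super- and subsolutions x/(B + sqrt(K^2 +
  x^2)) of the Riccati equation, chosen because exponentials of their antiderivatives are
  elementary. At \<nu> = -1/2 some of these expressions degenerate to 0^0 at the origin, so limits
  there need care.\<close>

text \<open>Monotonicity carries a sign from 0 to x. Only a minorant \<open>g\<close> has to tend to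
  0: in the applications it is the subtracted part of a difference, and the positive part may keep a
  nonzero limit, as it does in \<open>Bessel_ratio_le\<close> at \<nu> = -1/2.\<close>

lemma nonneg_if_deriv_nonneg:
  fixes f f' g :: "real \<Rightarrow> real"
  assumes "\<And>x. x > 0 \<Longrightarrow> (f has_real_derivative f' x) (at x)" "\<And>x. x > 0 \<Longrightarrow> f' x \<ge> 0"
    and "(g \<longlongrightarrow> 0) (at_right 0)" "\<And>x. x > 0 \<Longrightarrow> g x \<le> f x" and "x > 0"
  shows "f x \<ge> 0"
proof -
  have incr: "f u \<le> f v" if "0 < u" "u < v" for u v
    using that by (intro DERIV_nonneg_imp_nondecreasing[of u v f])
                  (auto intro!: exI assms(1,2))
  have "eventually (\<lambda>u. u < x) (at_right 0)" "eventually (\<lambda>u::real. u > 0) (at_right 0)"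
    using \<open>x > 0\<close> by real_asymp+
  hence "eventually (\<lambda>u. g u \<le> f x) (at_right 0)"
    by eventually_elim (meson incr assms(4) order_trans)
  thus ?thesis
    by (intro tendsto_upperbound[OF assms(3)]) auto
qed

lemma pos_if_deriv_pos:
  fixes f f' g :: "real \<Rightarrow> real"
  assumes "\<And>x. x > 0 \<Longrightarrow> (f has_real_derivative f' x) (at x)" "\<And>x. x > 0 \<Longrightarrow> f' x > 0"
    and "(g \<longlongrightarrow> 0) (at_right 0)" "\<And>x. x > 0 \<Longrightarrow> g x \<le> f x" and "x > 0"
  shows "f x > 0"
proof -
  have "0 \<le> f (x / 2)"
  proof (rule nonneg_if_deriv_nonneg[where f = f and f' = f' and g = g])
    show "f' u \<ge> 0" if "u > 0" for u using assms(2)[OF that] by simp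
  qed (use \<open>x > 0\<close> in \<open>simp_all add: assms(1,3,4)\<close>)
  also have "\<dots> < f x"
  proof (rule DERIV_pos_imp_increasing[where f = f])
    fix u assume "x / 2 \<le> u"
    with \<open>x > 0\<close> have "u > 0" by linarith
    thus "\<exists>y. (f has_real_derivative y) (at u) \<and> y > 0" using assms(1,2) by blast
  qed (use \<open>x > 0\<close> in simp)
  finally show ?thesis .
qed

lemma has_real_derivative_powr_const:
  fixes f :: "real \<Rightarrow> real"
  assumes "(f has_real_derivative f') (at x)" "f x > 0"
  shows "((\<lambda>x. f x powr c) has_real_derivative f x powr c * (c * f' / f x)) (at x)"
proof -
  have "((\<lambda>u. u powr c) has_real_derivative f x powr c * c / f x) (at (f x))"
    using assms(2) by (auto intro!: derivative_eq_intros simp: powr_diff)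
  from DERIV_chain2[OF this assms(1)] show ?thesis by (simp add: mult.assoc)
qed

lemma rGamma_pos_real: "(a::real) > 0 \<Longrightarrow> rGamma a > 0"
  by (simp add: rGamma_inverse_Gamma)

lemma rGamma_nonneg_real: "(a::real) \<ge> 0 \<Longrightarrow> rGamma a \<ge> 0"
  by (cases "a = 0") (auto simp: rGamma_pos_real less_imp_le)

section \<open>Convergence, recurrences and derivatives of the series\<close>

text \<open>The power series part, kept apart from the power of x: it is differentiable at every
  real z, hence continuous at 0, where \<open>lommel_F\<close> may be singular.\<close>

definition lommel_G :: "real \<Rightarrow> real \<Rightarrow> real \<Rightarrow> real" where
  "lommel_G a b z = (\<Sum>k. rGamma (real k + a) * rGamma (real k + b) * z ^ k)"

definition lommel_F :: "real \<Rightarrow> real \<Rightarrow> real \<Rightarrow> real" where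
  "lommel_F a b x = (x / 2) powr (a + b - 2) * lommel_G a b ((x / 2)\<^sup>2)"

lemma lommel_G_commute: "lommel_G a b z = lommel_G b a z"
  unfolding lommel_G_def by (simp add: mult_ac)

lemma lommel_F_commute: "lommel_F a b x = lommel_F b a x"
  unfolding lommel_F_def by (simp add: lommel_G_commute[of a] add_ac)

text \<open>Consecutive terms have ratio z/((n + a)(n + b)), kept cross-multiplied so that z = 0
  needs no separate case. The index N makes one factor of the denominator at least 2|z| + 1 and the
  other at least 1.\<close>

lemma summable_lommel_G:
  "summable (\<lambda>k. rGamma (real k + a) * rGamma (real k + b) * z ^ k)" (is "summable ?f")
proof (rule summable_ratio_test)
  define N where "N = nat \<lceil>\<bar>a\<bar> + \<bar>b\<bar> + 2 * \<bar>z\<bar> + 1\<rceil>"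
  show "(1/2::real) < 1" by simp
  fix n assume "n \<ge> N"
  hence n: "real n \<ge> \<bar>a\<bar> + \<bar>b\<bar> + 2 * \<bar>z\<bar> + 1" unfolding N_def by linarith
  have "(real n + a) * rGamma (real (Suc n) + a) = rGamma (real n + a)"
       "(real n + b) * rGamma (real (Suc n) + b) = rGamma (real n + b)"
    using rGamma_plus1[of "real n + a"] rGamma_plus1[of "real n + b"] by (simp_all add: add_ac)
  hence "?f n * z = (real n + a) * (real n + b) * ?f (Suc n)"
    by (metis mult.assoc mult.left_commute power_Suc2)
  hence "\<bar>?f n\<bar> * \<bar>z\<bar> = \<bar>(real n + a) * (real n + b)\<bar> * \<bar>?f (Suc n)\<bar>"
    by (metis abs_mult)
  moreover have "(2 * \<bar>z\<bar> + 1) * 1 \<le> (real n + a) * (real n + b)"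
    using n by (intro mult_mono) auto
  hence "(2 * \<bar>z\<bar> + 1) * \<bar>?f (Suc n)\<bar> \<le> \<bar>(real n + a) * (real n + b)\<bar> * \<bar>?f (Suc n)\<bar>"
    by (intro mult_right_mono) auto
  ultimately have *: "(2 * \<bar>z\<bar> + 1) * \<bar>?f (Suc n)\<bar> \<le> \<bar>?f n\<bar> * \<bar>z\<bar>" by simp
  have "\<bar>?f n\<bar> * \<bar>z\<bar> \<le> (2 * \<bar>z\<bar> + 1) * (\<bar>?f n\<bar> / 2)"
    using abs_ge_zero[of "?f n"] by (simp only: distrib_right mult_1_left) (simp add: mult.commute)
  with * have "(2 * \<bar>z\<bar> + 1) * \<bar>?f (Suc n)\<bar> \<le> (2 * \<bar>z\<bar> + 1) * (\<bar>?f n\<bar> / 2)"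
    by (rule order_trans)
  hence "\<bar>?f (Suc n)\<bar> \<le> \<bar>?f n\<bar> / 2"
    by (rule mult_left_le_imp_le) simp
  thus "norm (?f (Suc n)) \<le> 1/2 * norm (?f n)" by simp
qed

lemma lommel_G_sums:
  "(\<lambda>k. rGamma (real k + a) * rGamma (real k + b) * z ^ k) sums lommel_G a b z"
  unfolding lommel_G_def using summable_lommel_G by (rule summable_sums)

lemma lommel_F_sums:
  assumes "x > 0"
  shows "(\<lambda>k. (x / 2) powr (a + b - 2 + 2 * real k) * rGamma (real k + a) * rGamma (real k + b))
           sums lommel_F a b x"
proof -
  have "(x / 2) powr (a + b - 2) * ((x / 2)\<^sup>2) ^ k = (x / 2) powr (a + b - 2 + 2 * real k)" for k
    using assms powr_realpow[of "x/2" "2 * k"] by (simp add: powr_add power_mult)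
  thus ?thesis
    using sums_mult[OF lommel_G_sums[of a b "(x/2)\<^sup>2"], of "(x / 2) powr (a + b - 2)"]
    unfolding lommel_F_def by (simp add: mult_ac)
qed

lemma modified_Lommel_t_eq:
  assumes "x > 0"
  shows "modified_Lommel_t \<mu> \<nu> x = lommel_F ((\<mu> - \<nu> + 3) / 2) ((\<mu> + \<nu> + 3) / 2) x"
proof -
  have "(\<mu> - \<nu> + 3) / 2 + (\<mu> + \<nu> + 3) / 2 - 2 + 2 * real k = \<mu> + 2 * real k + 1" for k
    by (simp add: field_simps)
  thus ?thesis
    using sums_unique[OF lommel_F_sums[OF assms, of "(\<mu> - \<nu> + 3) / 2" "(\<mu> + \<nu> + 3) / 2"]]
    unfolding modified_Lommel_t_def by (simp add: add_ac)
qed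

lemma modified_Bessel_I_eq:
  assumes "x > 0"
  shows "modified_Bessel_I \<nu> x = lommel_F 1 (\<nu> + 1) x"
proof -
  have "rGamma (real k + 1) = 1 / fact k" for k
    by (simp add: rGamma_inverse_Gamma Gamma_fact add.commute divide_inverse)
  thus ?thesis
    using sums_unique[OF lommel_F_sums[OF assms, of 1 "\<nu> + 1"]]
    unfolding modified_Bessel_I_def by (simp add: add_ac mult_ac)
qed

lemma lommel_G_recurrence: "lommel_G a b z = rGamma a * rGamma b + z * lommel_G (a + 1) (b + 1) z"
proof -
  have "(\<lambda>k. rGamma (real (Suc k) + a) * rGamma (real (Suc k) + b) * z ^ Suc k)
          sums (z * lommel_G (a + 1) (b + 1) z)"
    using sums_mult[OF lommel_G_sums[of "a+1" "b+1" z], of z] by (simp add: algebra_simps)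
  from sums_Suc[OF this] have "lommel_G a b z = z * lommel_G (a + 1) (b + 1) z + rGamma a * rGamma b"
    using lommel_G_sums[of a b z] by (simp add: sums_iff)
  thus ?thesis by simp
qed

lemma lommel_F_recurrence:
  assumes "x > 0"
  shows "lommel_F a b x
           = (x / 2) powr (a + b - 2) * rGamma a * rGamma b + lommel_F (a + 1) (b + 1) x"
proof -
  have "(x / 2) powr (a + b) = (x / 2) powr (a + b - 2 + 2)" by simp
  also have "\<dots> = (x / 2) powr (a + b - 2) * (x / 2)\<^sup>2"
    using assms by (subst powr_add) (simp_all add: powr_numeral)
  finally show ?thesis
    unfolding lommel_F_def by (subst lommel_G_recurrence) (simp add: algebra_simps)
qed

text \<open>Multiplying the k-th coefficient by k + a - 1 lowers a by 1 inside the reciprocal Gamma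
  function. The derivative remains an unnamed D tied to an equation in z * D, so that z = 0 is
  covered and continuity there follows.\<close>

lemma lommel_G_has_derivative:
  "\<exists>D. (lommel_G a b has_real_derivative D) (at z) \<and> (a - 1) * lommel_G a b z + z * D = lommel_G (a - 1) b z"
proof -
  define c where "c = (\<lambda>k. rGamma (real k + a) * rGamma (real k + b))"
  define D where "D = (\<Sum>n. diffs c n * z ^ n)"
  have sm: "summable (\<lambda>n. c n * y ^ n)" for y
    unfolding c_def by (rule summable_lommel_G)
  have D: "(lommel_G a b has_real_derivative D) (at z)"
    using termdiffs_strong_converges_everywhere[of c z, OF sm]
    unfolding D_def c_def lommel_G_def by simp
  have "summable (\<lambda>n. diffs c n * z ^ n)"
    by (rule termdiff_converges_all) (rule sm)
  hence "(\<lambda>n. diffs c n * z ^ n) sums D" unfolding D_def by (rule summable_sums)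
  from sums_mult[OF this, of z] have "(\<lambda>n. of_nat (Suc n) * c (Suc n) * z ^ Suc n) sums (z * D)"
    by (simp add: diffs_def mult_ac)
  hence "(\<lambda>n. of_nat n * c n * z ^ n) sums (z * D)"
    by (subst (asm) sums_Suc_iff) simp
  from sums_add[OF sums_mult[OF lommel_G_sums[of a b z], of "a - 1"] this]
  have "(\<lambda>k. (real k + a - 1) * c k * z ^ k) sums ((a - 1) * lommel_G a b z + z * D)"
    unfolding c_def by (simp add: algebra_simps)
  moreover have "(real k + a - 1) * c k = rGamma (real k + (a - 1)) * rGamma (real k + b)" for k
    using rGamma_plus1[of "real k + (a - 1)"]
    by (simp add: c_def flip: mult.assoc add_diff_eq)
  ultimately have "(a - 1) * lommel_G a b z + z * D = lommel_G (a - 1) b z"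
    using lommel_G_sums[of "a - 1" b z] by (simp add: sums_unique2)
  with D show ?thesis by blast
qed

lemma isCont_lommel_G: "isCont (lommel_G a b) z"
  using lommel_G_has_derivative[of a b z] DERIV_isCont by blast

text \<open>The exponent splits as a + b - 2 + 2k = (b - a) + 2(k + a - 1), and the second part
  lowers a. The symmetric splitting lowers b; it is the primed version.\<close>

lemma lommel_F_has_derivative:
  assumes "x > 0"
  shows "(lommel_F a b has_real_derivative ((b - a) / x * lommel_F a b x + lommel_F (a - 1) b x)) (at x)"
proof -
  obtain D where D: "(lommel_G a b has_real_derivative D) (at ((x / 2)\<^sup>2))"
    "(a - 1) * lommel_G a b ((x / 2)\<^sup>2) + (x / 2)\<^sup>2 * D = lommel_G (a - 1) b ((x / 2)\<^sup>2)"
    using lommel_G_has_derivative by blast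
  have 2: "((\<lambda>x. lommel_G a b ((x / 2)\<^sup>2)) has_real_derivative D * (x / 2)) (at x)"
    by (rule DERIV_chain2[where f = "lommel_G a b" and g = "\<lambda>x. (x / 2)\<^sup>2", OF D(1)]) (auto intro!: derivative_eq_intros)
  have 1: "((\<lambda>x. (x / 2) powr (a + b - 2)) has_real_derivative
      ((a + b - 2) * (x / 2) powr (a + b - 3) / 2)) (at x)"
    using assms by (auto intro!: derivative_eq_intros simp: algebra_simps)
  have "(lommel_F a b has_real_derivative
      (a + b - 2) * (x / 2) powr (a + b - 3) / 2 * lommel_G a b ((x / 2)\<^sup>2)
        + D * (x / 2) * (x / 2) powr (a + b - 2)) (at x)"
    unfolding lommel_F_def [abs_def] by (rule DERIV_mult[OF 1 2])
  moreover have P: "(x / 2) powr (a + b - 2) = (x / 2) powr (a + b - 3) * (x / 2)"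
    using powr_add[of "x/2" "a + b - 3" 1] assms by simp
  have *: "(a + b - 2) * p / 2 * g + D * (x / 2) * (p * (x / 2))
          = (b - a) / x * (p * (x / 2) * g) + p * ((a - 1) * g + (x / 2)\<^sup>2 * D)" for p g
    using assms by (simp add: field_simps power2_eq_square)
  have "(a + b - 2) * (x / 2) powr (a + b - 3) / 2 * lommel_G a b ((x / 2)\<^sup>2)
           + D * (x / 2) * (x / 2) powr (a + b - 2)
         = (b - a) / x * lommel_F a b x + lommel_F (a - 1) b x"
    using *[of "(x / 2) powr (a + b - 3)" "lommel_G a b ((x / 2)\<^sup>2)"]
    unfolding lommel_F_def D(2)[symmetric] P by (simp only: diff_add_eq) simp
  ultimately show ?thesis by simp
qed

lemma lommel_F_has_derivative':
  assumes "x > 0"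
  shows "(lommel_F a b has_real_derivative ((a - b) / x * lommel_F a b x + lommel_F a (b - 1) x)) (at x)"
proof -
  have "lommel_F a b = lommel_F b a" using lommel_F_commute by blast
  thus ?thesis using lommel_F_has_derivative[OF assms, of b a]
    unfolding lommel_F_commute[of b a x] lommel_F_commute[of "b - 1" a x] by simp
qed

lemma lommel_G_pos:
  assumes "a > 0" "b \<ge> 0" "z > 0"
  shows "lommel_G a b z > 0"
  using assms summable_lommel_G unfolding lommel_G_def
  by (intro suminf_pos2[of _ 1])
     (auto intro!: mult_nonneg_nonneg mult_pos_pos rGamma_pos_real rGamma_nonneg_real)

lemma lommel_F_pos:
  assumes "a > 0" "b \<ge> 0" "x > 0"
  shows "lommel_F a b x > 0"
  using assms unfolding lommel_F_def by (auto intro!: mult_pos_pos lommel_G_pos)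

section \<open>Behaviour at 0\<close>

lemma lommel_G_tendsto: "((\<lambda>x. lommel_G a b ((x / 2)\<^sup>2)) \<longlongrightarrow> rGamma a * rGamma b) (at_right 0)"
proof -
  have "((\<lambda>x::real. (x / 2)\<^sup>2) \<longlongrightarrow> 0) (at_right 0)" by real_asymp
  from isCont_tendsto_compose[OF isCont_lommel_G this, of a b]
  show ?thesis using lommel_G_recurrence[of a b 0] by (simp del: zero_less_power2)
qed

lemma powr_mult_lommel_F_tendsto_0:
  assumes "e + a + b > 2"
  shows "((\<lambda>x. x powr e * lommel_F a b x) \<longlongrightarrow> 0) (at_right 0)"
proof -
  have "((\<lambda>x. (1/2) powr (a + b - 2) * x powr (e + a + b - 2) * lommel_G a b ((x / 2)\<^sup>2))
           \<longlongrightarrow> (1/2) powr (a + b - 2) * 0 * (rGamma a * rGamma b)) (at_right 0)"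
    using assms by (intro tendsto_intros lommel_G_tendsto) real_asymp
  moreover have "eventually (\<lambda>x::real. x > 0) (at_right 0)" by real_asymp
  hence "eventually (\<lambda>x. (1/2) powr (a + b - 2) * x powr (e + a + b - 2) * lommel_G a b ((x / 2)\<^sup>2)
           = x powr e * lommel_F a b x) (at_right 0)"
  proof eventually_elim
    case (elim x)
    have "x powr (e + a + b - 2) = x powr e * x powr (a + b - 2)"
      by (subst powr_add[symmetric]) (simp add: algebra_simps)
    moreover have "(x / 2) powr (a + b - 2) = (1/2) powr (a + b - 2) * x powr (a + b - 2)"
      using elim by (subst powr_mult[symmetric]) auto
    ultimately show ?case by (simp add: lommel_F_def)
  qed
  ultimately show ?thesis by (auto intro: Lim_transform_eventually)
qed

lemma mult_lommel_F_lommel_F_tendsto_0: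
  assumes "a + b + c + d > 3"
  shows "((\<lambda>x. x * (lommel_F a b x * lommel_F c d x)) \<longlongrightarrow> 0) (at_right 0)"
proof -
  \<comment> \<open>Half of the surplus: each factor is left with a positive power x^h, and the two
    compensating exponents add up to 1.\<close>
  define h where "h = (a + b + c + d - 3) / 2"
  have "((\<lambda>x. (x powr (2 + h - a - b) * lommel_F a b x) * (x powr (2 + h - c - d) * lommel_F c d x))
         \<longlongrightarrow> 0 * 0) (at_right 0)"
    by (intro tendsto_mult powr_mult_lommel_F_tendsto_0) (use assms in \<open>auto simp: h_def\<close>)
  moreover have "eventually (\<lambda>x::real. x > 0) (at_right 0)" by real_asymp
  hence "eventually (\<lambda>x. (x powr (2 + h - a - b) * lommel_F a b x) * (x powr (2 + h - c - d) * lommel_F c d x)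
           = x * (lommel_F a b x * lommel_F c d x)) (at_right 0)"
  proof eventually_elim
    case (elim x)
    have "x powr (2 + h - a - b) * x powr (2 + h - c - d) = x powr 1"
      by (subst powr_add[symmetric]) (simp add: h_def field_simps)
    thus ?case using elim by simp
  qed
  ultimately show ?thesis by (auto intro: Lim_transform_eventually)
qed

section \<open>The first term of the series\<close>

definition lommel_term0 :: "real \<Rightarrow> real \<Rightarrow> real \<Rightarrow> real" where
  "lommel_term0 a b x = (x / 2) powr (a + b - 2) * rGamma a * rGamma b"

lemma lommel_term0_pos: "a > 0 \<Longrightarrow> b > 0 \<Longrightarrow> x > 0 \<Longrightarrow> lommel_term0 a b x > 0"
  by (auto simp: lommel_term0_def intro!: mult_pos_pos rGamma_pos_real)

lemma lommel_F_eq_term0: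
  "x > 0 \<Longrightarrow> lommel_F a b x = lommel_term0 a b x + lommel_F (a + 1) (b + 1) x"
  unfolding lommel_term0_def by (rule lommel_F_recurrence)

lemma lommel_term0_Suc:
  assumes "x > 0"
  shows "lommel_term0 a b x * (x / 2)\<^sup>2 = a * b * lommel_term0 (a + 1) (b + 1) x"
proof -
  have "(x / 2) powr (a + b - 2) * (x / 2)\<^sup>2 = (x / 2) powr (a + 1 + (b + 1) - 2)"
    using assms powr_add[of "x / 2" "a + b - 2" 2] by (simp add: powr_numeral)
  thus ?thesis
    unfolding lommel_term0_def rGamma_plus1[symmetric, of a] rGamma_plus1[symmetric, of b]
    by (simp add: mult_ac)
qed

text \<open>An index shift leaves over the k = 0 term of \<open>lommel_F (a - 1) b\<close>. This
  summand is the only difference between the first-order equations of t and those of a Bessel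
  function, where a = 1 makes it vanish.\<close>

lemma lommel_F_eq_Suc:
  assumes "x > 0"
  shows "lommel_F (a - 1) b x = lommel_F a (b + 1) x + 2 * (a - 1) / x * lommel_term0 a b x"
proof -
  have P: "(x / 2) powr (a + b - 2) = (x / 2) powr (a - 1 + b - 2) * (x / 2)"
    using assms powr_add[of "x / 2" "a - 1 + b - 2" 1] by (simp add: diff_add_eq)
  have "2 * (a - 1) / x * lommel_term0 a b x = lommel_term0 (a - 1) b x"
    using assms unfolding lommel_term0_def P rGamma_plus1[of "a - 1", symmetric] by simp
  thus ?thesis using lommel_F_eq_term0[OF assms, of "a - 1" b] by simp
qed

lemma lommel_F_0_left: "x > 0 \<Longrightarrow> lommel_F 0 b x = lommel_F 1 (b + 1) x"
  using lommel_F_recurrence[of x 0 b] by simp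

text \<open>Only the terms k = 0 and k = 1 are kept; the second is x^2/(4ab) times the first. Since
  4ab = (\<mu> + 3)^2 - \<nu>^2 for t, this is the source of that expression in the theorem.\<close>

lemma lommel_term0_le:
  assumes "a > 0" "b > 0" "x > 0"
  shows "lommel_term0 a b x * (4 * a * b + x\<^sup>2) \<le> 4 * a * b * lommel_F a b x"
proof -
  have "0 < lommel_F (a + 1 + 1) (b + 1 + 1) x" using assms by (intro lommel_F_pos) auto
  hence "lommel_term0 (a + 1) (b + 1) x \<le> lommel_F (a + 1) (b + 1) x"
    using lommel_F_eq_term0[OF \<open>x > 0\<close>, of "a + 1" "b + 1"] by linarith
  hence "4 * a * b * (lommel_term0 a b x + lommel_term0 (a + 1) (b + 1) x) \<le> 4 * a * b * lommel_F a b x"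
    using lommel_F_eq_term0[OF \<open>x > 0\<close>, of a b] assms by (intro mult_left_mono) auto
  thus ?thesis using lommel_term0_Suc[OF \<open>x > 0\<close>, of a b]
    by (simp add: algebra_simps power2_eq_square)
qed

lemma lommel_term0_less:
  assumes "a > 0" "b > 0" "x > 0"
  shows "lommel_term0 a b x < lommel_F a b x"
  using lommel_F_eq_term0[OF \<open>x > 0\<close>, of a b] lommel_F_pos[of "a+1" "b+1" x] assms by simp

section \<open>Comparison of first-order equations\<close>

text \<open>Both products in D satisfy equations with the same coefficient -1/x, which the factor x
  removes, and the mixed products cancel. What remains of the derivative is the contribution of the
  first term of t, positive because a > 1.\<close>

lemma lommel_ratio_less_Bessel_ratio:
  assumes "a > 1" "b \<ge> a - 1" "x > 0"
  shows "lommel_F a (b + 1) x * lommel_F 1 (b - a + 1) x < lommel_F a b x * lommel_F 1 (b - a + 2) x"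
proof -
  define c where "c = b - a + 1"
  have c: "b - a = c - 1" "a - (b + 1) = - c" by (simp_all add: c_def)
  define D where "D = (\<lambda>x. x * (lommel_F a b x * lommel_F 1 (c + 1) x - lommel_F a (b + 1) x * lommel_F 1 c x))"
  have "D x > 0"
  proof (rule pos_if_deriv_pos[where f = "D"
        and f' = "\<lambda>x. 2 * (a - 1) * lommel_term0 a b x * lommel_F 1 (c + 1) x"
        and g = "\<lambda>x. - (x * (lommel_F a (b + 1) x * lommel_F 1 c x))"])
    fix x :: real assume x: "x > 0"
    note d1 = lommel_F_has_derivative[OF x, of a b, unfolded lommel_F_eq_Suc[OF x] c]
    note d2 = lommel_F_has_derivative'[OF x, of a "b + 1", unfolded c]
    note d3 = lommel_F_has_derivative[OF x, of 1 c]
    note d4 = lommel_F_has_derivative'[OF x, of 1 "c + 1"]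
    have 0: "lommel_F 0 c x = lommel_F 1 (c + 1) x" using lommel_F_0_left[OF x] .
    show "(D has_real_derivative 2 * (a - 1) * lommel_term0 a b x * lommel_F 1 (c + 1) x) (at x)"
      unfolding D_def using x
      by (intro DERIV_cong[OF DERIV_mult[OF DERIV_ident DERIV_diff[OF DERIV_mult[OF d1 d4] DERIV_mult[OF d2 d3]]]])
         (simp add: 0 field_simps)
    show "2 * (a - 1) * lommel_term0 a b x * lommel_F 1 (c + 1) x > 0"
      using assms x by (intro mult_pos_pos lommel_term0_pos lommel_F_pos) (auto simp: c_def)
    have "0 < x * (lommel_F a b x * lommel_F 1 (c + 1) x)"
      using assms x by (intro mult_pos_pos lommel_F_pos) (auto simp: c_def)
    thus "- (x * (lommel_F a (b + 1) x * lommel_F 1 c x)) \<le> D x" 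
      by (simp add: D_def algebra_simps)
  next
    have "((\<lambda>x. - (x * (lommel_F a (b + 1) x * lommel_F 1 c x))) \<longlongrightarrow> - 0) (at_right 0)"
      using assms by (intro tendsto_minus mult_lommel_F_lommel_F_tendsto_0) (auto simp: c_def)
    thus "((\<lambda>x. - (x * (lommel_F a (b + 1) x * lommel_F 1 c x))) \<longlongrightarrow> 0) (at_right 0)" by simp
  qed fact
  thus ?thesis using assms by (simp add: D_def c_def zero_less_mult_iff add.commute)
qed

text \<open>The same cancellation with a lowered instead of b raised: the surplus is now the first
  term of \<open>lommel_F (a - 1) (b - 1)\<close>, which b > 1 makes positive. For t this condition
  reads \<mu> + \<nu> > -1.\<close>

lemma Bessel_ratio_less_lommel_ratio:
  assumes "a > 1" "b > 1" "b \<ge> a - 1" "x > 0"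
  shows "lommel_F a b x * lommel_F 1 (b - a + 2) x < lommel_F (a - 1) b x * lommel_F 1 (b - a + 1) x"
proof -
  define c where "c = b - a + 1"
  have c: "b - a = c - 1" "a - 1 - b = - c" by (simp_all add: c_def)
  define D where "D = (\<lambda>x. x * (lommel_F (a - 1) b x * lommel_F 1 c x - lommel_F a b x * lommel_F 1 (c + 1) x))"
  have "D x > 0"
  proof (rule pos_if_deriv_pos[where f = "D"
        and f' = "\<lambda>x. x * lommel_term0 (a - 1) (b - 1) x * lommel_F 1 c x"
        and g = "\<lambda>x. - (x * (lommel_F a b x * lommel_F 1 (c + 1) x))"])
    fix x :: real assume x: "x > 0"
    note d1 = lommel_F_has_derivative[OF x, of a b, unfolded c]
    note d2 = lommel_F_has_derivative'[OF x, of "a - 1" b, unfolded c lommel_F_eq_term0[OF x, of "a - 1" "b - 1"]]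
    note d3 = lommel_F_has_derivative[OF x, of 1 c]
    note d4 = lommel_F_has_derivative'[OF x, of 1 "c + 1"]
    have 0: "lommel_F 0 c x = lommel_F 1 (c + 1) x" using lommel_F_0_left[OF x] .
    show "(D has_real_derivative x * lommel_term0 (a - 1) (b - 1) x * lommel_F 1 c x) (at x)"
      unfolding D_def using x
      by (intro DERIV_cong[OF DERIV_mult[OF DERIV_ident DERIV_diff[OF DERIV_mult[OF d2 d3] DERIV_mult[OF d1 d4]]]])
         (simp add: 0 field_simps)
    show "x * lommel_term0 (a - 1) (b - 1) x * lommel_F 1 c x > 0"
      using assms x by (intro mult_pos_pos lommel_term0_pos lommel_F_pos) (auto simp: c_def)
    have "0 < x * (lommel_F (a - 1) b x * lommel_F 1 c x)"
      using assms x by (intro mult_pos_pos lommel_F_pos) (auto simp: c_def)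
    thus "- (x * (lommel_F a b x * lommel_F 1 (c + 1) x)) \<le> D x" 
      by (simp add: D_def algebra_simps)
  next
    have "((\<lambda>x. - (x * (lommel_F a b x * lommel_F 1 (c + 1) x))) \<longlongrightarrow> - 0) (at_right 0)"
      using assms by (intro tendsto_minus mult_lommel_F_lommel_F_tendsto_0) (auto simp: c_def)
    thus "((\<lambda>x. - (x * (lommel_F a b x * lommel_F 1 (c + 1) x))) \<longlongrightarrow> 0) (at_right 0)" by simp
  qed fact
  thus ?thesis using assms by (simp add: D_def c_def zero_less_mult_iff add.commute)
qed

section \<open>Explicit bounds by Riccati comparison\<close>

lemma sqrt_sq_add_tendsto:
  fixes K :: real
  assumes "K \<ge> 0"
  shows "((\<lambda>x. sqrt (K\<^sup>2 + x\<^sup>2)) \<longlongrightarrow> K) (at_right 0)"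
proof -
  have "((\<lambda>x. sqrt (K\<^sup>2 + x\<^sup>2)) \<longlongrightarrow> sqrt (K\<^sup>2 + 0\<^sup>2)) (at_right 0)"
    by (intro tendsto_intros)
  thus ?thesis using assms by simp
qed

text \<open>The case B = K = e = 0 is included: for x > 0 the base is positive and the power is 1,
  whereas \<open>powr\<close> at base 0 would give 0; hence \<open>rpow\<close> in the limit. The
  case arises at \<nu> = -1/2.\<close>

lemma powr_add_sqrt_tendsto:
  fixes K B e :: real
  assumes "K \<ge> 0" "B \<ge> 0" "B + K > 0 \<or> e = 0"
  shows "((\<lambda>x. (B + sqrt (K\<^sup>2 + x\<^sup>2)) powr e) \<longlongrightarrow> rpow (B + K) e) (at_right 0)"
proof (cases "e = 0")
  case True
  have "eventually (\<lambda>x::real. x > 0) (at_right 0)" by real_asymp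
  hence "eventually (\<lambda>x. 1 = (B + sqrt (K\<^sup>2 + x\<^sup>2)) powr e) (at_right 0)"
  proof eventually_elim
    case (elim x)
    hence "sqrt (K\<^sup>2 + x\<^sup>2) > 0" by (simp add: add_nonneg_pos)
    hence "B + sqrt (K\<^sup>2 + x\<^sup>2) > 0" using assms by linarith
    thus ?case using True by simp
  qed
  from Lim_transform_eventually[OF tendsto_const this]
  show ?thesis using True by (simp add: rpow_def)
next
  case False
  thus ?thesis using assms unfolding rpow_def
    by (auto intro!: tendsto_intros sqrt_sq_add_tendsto)
qed

lemma sqrt_sq_add_has_derivative:
  fixes K x :: real
  assumes "x > 0"
  shows "((\<lambda>x. sqrt (K\<^sup>2 + x\<^sup>2)) has_real_derivative x / sqrt (K\<^sup>2 + x\<^sup>2)) (at x)"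
proof -
  have "K\<^sup>2 + x\<^sup>2 > 0" using assms by (simp add: add_nonneg_pos)
  thus ?thesis by (auto intro!: derivative_eq_intros simp: field_simps)
qed

text \<open>Origin of the explicit functions in the theorem: with s = sqrt(K^2 + x^2) and s' = x/s
  the logarithmic derivative is s' (1 - B/(B + s)) = x/(B + s), so the Riccati barriers integrate to
  elementary functions.\<close>

lemma exp_sqrt_powr_has_derivative:
  fixes K B x :: real
  assumes "x > 0" "B + sqrt (K\<^sup>2 + x\<^sup>2) > 0"
  shows "((\<lambda>x. exp (sqrt (K\<^sup>2 + x\<^sup>2)) * (B + sqrt (K\<^sup>2 + x\<^sup>2)) powr (- B)) has_real_derivative
          exp (sqrt (K\<^sup>2 + x\<^sup>2)) * (B + sqrt (K\<^sup>2 + x\<^sup>2)) powr (- B) * (x / (B + sqrt (K\<^sup>2 + x\<^sup>2)))) (at x)"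
proof -
  define s where "s = sqrt (K\<^sup>2 + x\<^sup>2)"
  have s: "s > 0" using assms by (simp add: s_def add_nonneg_pos)
  have d: "((\<lambda>x. sqrt (K\<^sup>2 + x\<^sup>2)) has_real_derivative x / s) (at x)"
    unfolding s_def by (rule sqrt_sq_add_has_derivative[OF assms(1)])
  have "((\<lambda>x. exp (sqrt (K\<^sup>2 + x\<^sup>2)) * (B + sqrt (K\<^sup>2 + x\<^sup>2)) powr (- B)) has_real_derivative
     (exp s * (x / s)) * (B + s) powr (- B) + (B + s) powr (- B) * ((- B) * (0 + x / s) / (B + s)) * exp s) (at x)"
    using DERIV_mult[OF DERIV_chain2[OF DERIV_exp d]
            has_real_derivative_powr_const[OF DERIV_add[OF DERIV_const d] assms(2), of "- B"]]
    unfolding s_def .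
  moreover have "(e * (x / s)) * p + p * ((- B) * (0 + x / s) / (B + s)) * e = e * p * (x / (B + s))" for e p
    using s assms(2) unfolding s_def[symmetric] by (simp add: divide_simps) (simp add: algebra_simps)
  ultimately show ?thesis unfolding s_def by simp
qed

text \<open>
  The quotient $v/t$ of \<^term>\<open>v = lommel_F a (b + 1)\<close> and \<^term>\<open>t = lommel_F a b\<close> solves a Riccati equation.
  Comparing it with $y$ amounts to a sign of $v - y t$, whose equation is linear and has an
  elementary integrating factor.
\<close>

lemma Riccati_comparison_has_derivative:
  fixes a b B K x :: real
  assumes "x > 0" "B + sqrt (K\<^sup>2 + x\<^sup>2) > 0"
  defines "M \<equiv> (\<lambda>x. x powr (b - a + 1) * (exp (sqrt (K\<^sup>2 + x\<^sup>2)) * (B + sqrt (K\<^sup>2 + x\<^sup>2)) powr (- B)))"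
  defines "y \<equiv> (\<lambda>x. x / (B + sqrt (K\<^sup>2 + x\<^sup>2)))"
  defines "y' \<equiv> 1 / (B + sqrt (K\<^sup>2 + x\<^sup>2)) - x\<^sup>2 / (sqrt (K\<^sup>2 + x\<^sup>2) * (B + sqrt (K\<^sup>2 + x\<^sup>2))\<^sup>2)"
  shows "((\<lambda>x. M x * (lommel_F a (b + 1) x - y x * lommel_F a b x)) has_real_derivative
           M x * (lommel_F a b x * (1 - (2 * (b - a) + 1) / x * y x - (y x)\<^sup>2 - y')
                  - y x * (2 * (a - 1) / x) * lommel_term0 a b x)) (at x)"
proof -
  define s where "s = sqrt (K\<^sup>2 + x\<^sup>2)"
  have s: "s > 0" "B + s > 0" using assms by (simp_all add: s_def add_nonneg_pos)
  have "((\<lambda>x. x powr (b - a + 1)) has_real_derivative (b - a + 1) / x * x powr (b - a + 1)) (at x)"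
    using has_real_derivative_powr_const[OF DERIV_ident assms(1)] by (simp add: mult.commute)
  from DERIV_mult[OF this exp_sqrt_powr_has_derivative[OF assms(1,2)]]
  have dM: "(M has_real_derivative M x * ((b - a + 1) / x + y x)) (at x)"
    unfolding M_def y_def by (simp add: algebra_simps)
  have "(y has_real_derivative (1 * (B + s) - x * (x / s)) / ((B + s) * (B + s))) (at x)"
    unfolding y_def s_def using assms(1,2)
    by (intro DERIV_cong[OF DERIV_divide[OF DERIV_ident
          DERIV_add[OF DERIV_const sqrt_sq_add_has_derivative[OF assms(1)]]]]) auto
  moreover have "(1 * (B + s) - x * (x / s)) / ((B + s) * (B + s)) = y'"
    unfolding y'_def s_def[symmetric] using s by (simp add: divide_simps power2_eq_square)
  ultimately have dy: "(y has_real_derivative y') (at x)" by simp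
  note dt = lommel_F_has_derivative[OF assms(1), of a b, unfolded lommel_F_eq_Suc[OF assms(1)]]
  note dv = lommel_F_has_derivative'[OF assms(1), of a "b + 1"]
  show ?thesis
    by (intro DERIV_cong[OF DERIV_mult[OF dM DERIV_diff[OF dv DERIV_mult[OF dy dt]]]])
       (use assms(1) in \<open>simp add: field_simps power2_eq_square\<close>)
qed

lemma Riccati_factor_tendsto_0:
  fixes a b B K e :: real
  assumes "B \<ge> 0" "K \<ge> 0" "e + a + b > 2"
  shows "((\<lambda>x. x powr e * (exp (sqrt (K\<^sup>2 + x\<^sup>2)) * (B + sqrt (K\<^sup>2 + x\<^sup>2)) powr (- B)) * lommel_F a b x)
           \<longlongrightarrow> 0) (at_right 0)"
proof -
  have "((\<lambda>x. (exp (sqrt (K\<^sup>2 + x\<^sup>2)) * (B + sqrt (K\<^sup>2 + x\<^sup>2)) powr (- B)) * (x powr e * lommel_F a b x))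
           \<longlongrightarrow> (exp K * rpow (B + K) (- B)) * 0) (at_right 0)"
    using assms by (intro tendsto_intros sqrt_sq_add_tendsto powr_add_sqrt_tendsto powr_mult_lommel_F_tendsto_0) auto
  thus ?thesis by (simp add: mult_ac)
qed

text \<open>With s = sqrt(B^2 + x^2), the barrier x/(B + s) is the positive root y of y^2 + (2B/x) y
  = 1, where the Riccati right-hand side for I_(\<nu>+1)/I_\<nu> vanishes. Its derivative B/(s(B +
  s)) is nonnegative, so it is a supersolution.\<close>

lemma Bessel_ratio_le:
  fixes \<nu> x :: real
  assumes "\<nu> \<ge> -1/2" "x > 0"
  defines "B \<equiv> \<nu> + 1 / 2"
  shows "lommel_F 1 (\<nu> + 2) x \<le> x / (B + sqrt (B\<^sup>2 + x\<^sup>2)) * lommel_F 1 (\<nu> + 1) x"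
proof -
  define M where "M = (\<lambda>x. x powr (\<nu> + 1 - 1 + 1) * (exp (sqrt (B\<^sup>2 + x\<^sup>2)) * (B + sqrt (B\<^sup>2 + x\<^sup>2)) powr (- B)))"
  define y where "y = (\<lambda>x. x / (B + sqrt (B\<^sup>2 + x\<^sup>2)))"
  define N where "N = (\<lambda>x. M x * (lommel_F 1 (\<nu> + 1 + 1) x - y x * lommel_F 1 (\<nu> + 1) x))"
  have B: "B \<ge> 0" using assms by simp
  have s: "sqrt (B\<^sup>2 + x\<^sup>2) > 0" "B + sqrt (B\<^sup>2 + x\<^sup>2) > 0" if "x > 0" for x
    using that B by (auto simp: add_nonneg_pos)
  have M: "M x > 0" if "x > 0" for x
    using s(2)[OF that] that by (simp add: M_def)
  have "- N x \<ge> 0"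
  proof (rule nonneg_if_deriv_nonneg[where f = "\<lambda>x. - N x"
        and f' = "\<lambda>x. M x * (lommel_F 1 (\<nu> + 1) x * (B / (sqrt (B\<^sup>2 + x\<^sup>2) * (B + sqrt (B\<^sup>2 + x\<^sup>2)))))"
        and g = "\<lambda>x. - (M x * lommel_F 1 (\<nu> + 1 + 1) x)"])
    fix x :: real assume x: "x > 0"
    define s where "s = sqrt (B\<^sup>2 + x\<^sup>2)"
    have s: "s > 0" "B + s > 0" using s[OF x] by (simp_all add: s_def)
    have s2: "x\<^sup>2 = s\<^sup>2 - B\<^sup>2" by (simp add: s_def)
    have "1 - 2 * B / x * y x - (y x)\<^sup>2 = ((B + s)\<^sup>2 - 2 * B * (B + s) - x\<^sup>2) / (B + s)\<^sup>2"
      using s x unfolding y_def s_def[symmetric]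
      by (simp add: divide_simps power2_eq_square) (simp add: algebra_simps)
    also have "\<dots> = 0" unfolding s2 by (simp add: algebra_simps power2_eq_square)
    finally have 1: "1 - 2 * B / x * y x - (y x)\<^sup>2 = 0" .
    have "1 / (B + s) - x\<^sup>2 / (s * (B + s)\<^sup>2) = ((B + s) * s - x\<^sup>2) / (s * (B + s)\<^sup>2)"
      using s by (simp add: divide_simps power2_eq_square)
    also have "(B + s) * s - x\<^sup>2 = B * (B + s)"
      unfolding s2 by (simp add: algebra_simps power2_eq_square)
    finally have 2: "1 / (B + s) - x\<^sup>2 / (s * (B + s)\<^sup>2) = B / (s * (B + s))"
      using s by (simp add: divide_simps power2_eq_square)
    have "2 * (\<nu> + 1 - 1) + 1 = 2 * B" by (simp add: B_def)
    hence "(N has_real_derivative M x * (lommel_F 1 (\<nu> + 1) x * (- (B / (s * (B + s)))))) (at x)"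
      using Riccati_comparison_has_derivative[of x B B "\<nu> + 1" 1] x s 1 2
      unfolding N_def M_def y_def s_def by simp
    from DERIV_minus[OF this]
    show "((\<lambda>x. - N x) has_real_derivative M x * (lommel_F 1 (\<nu> + 1) x * (B / (sqrt (B\<^sup>2 + x\<^sup>2) * (B + sqrt (B\<^sup>2 + x\<^sup>2)))))) (at x)"
      by (simp add: s_def)
    show "0 \<le> M x * (lommel_F 1 (\<nu> + 1) x * (B / (sqrt (B\<^sup>2 + x\<^sup>2) * (B + sqrt (B\<^sup>2 + x\<^sup>2)))))"
      unfolding s_def[symmetric] using M[OF x] B s lommel_F_pos[of 1 "\<nu> + 1" x] assms x by (intro mult_nonneg_nonneg) auto
    show "- (M x * lommel_F 1 (\<nu> + 1 + 1) x) \<le> - N x"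
      using M[OF x] s B lommel_F_pos[of 1 "\<nu> + 1" x] assms(1) x
      unfolding N_def y_def s_def by (simp add: algebra_simps)
  next
    have "((\<lambda>x. - (M x * lommel_F 1 (\<nu> + 1 + 1) x)) \<longlongrightarrow> - 0) (at_right 0)"
      unfolding M_def using assms(1) B by (intro tendsto_minus Riccati_factor_tendsto_0) auto
    thus "((\<lambda>x. - (M x * lommel_F 1 (\<nu> + 1 + 1) x)) \<longlongrightarrow> 0) (at_right 0)" by simp
  qed fact
  hence "lommel_F 1 (\<nu> + 1 + 1) x - y x * lommel_F 1 (\<nu> + 1) x \<le> 0"
    using M[OF assms(2)] by (simp add: N_def mult_le_0_iff)
  thus ?thesis by (simp add: y_def add.assoc)
qed

text \<open>An explicit subsolution. Replacing the first term of t by t itself only lowers the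
  right-hand side and turns it into 1 - (2b - 1) y/x - y^2. The choice B + K = 2b gives the barrier
  the same leading behaviour x/(2b) at 0 as the quotient; at a = 1 the constants B, K become \<nu> +
  1/2 and \<nu> + 3/2, as in the classical lower bound for I_(\<nu>+1)/I_\<nu>.\<close>

lemma lommel_ratio_greater:
  fixes a b x :: real
  assumes "a > 1" "b \<ge> a - 1" "a + b \<ge> 5/2" "x > 0"
  defines "B \<equiv> a + b - 3 / 2" and "K \<equiv> b - a + 3 / 2"
  shows "x / (B + sqrt (K\<^sup>2 + x\<^sup>2)) * lommel_F a b x < lommel_F a (b + 1) x"
proof -
  define M where "M = (\<lambda>x. x powr (b - a + 1) * (exp (sqrt (K\<^sup>2 + x\<^sup>2)) * (B + sqrt (K\<^sup>2 + x\<^sup>2)) powr (- B)))"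
  define y where "y = (\<lambda>x. x / (B + sqrt (K\<^sup>2 + x\<^sup>2)))"
  define N where "N = (\<lambda>x. M x * (lommel_F a (b + 1) x - y x * lommel_F a b x))"
  have B: "B > 0" and K: "K > 0" and b: "b > 0" using assms by simp_all
  have s: "sqrt (K\<^sup>2 + x\<^sup>2) > 0" "B + sqrt (K\<^sup>2 + x\<^sup>2) > 0" for x
    using B K by (simp_all add: add_pos_nonneg)
  have M: "M x > 0" if "x > 0" for x
    using s(2)[of x] that by (simp add: M_def)
  have "N x > 0"
  proof (rule pos_if_deriv_pos[where f = "N"
        and f' = "\<lambda>x. M x * (lommel_F a b x * (1 - (2 * (b - a) + 1) / x * y x - (y x)\<^sup>2
          - (1 / (B + sqrt (K\<^sup>2 + x\<^sup>2)) - x\<^sup>2 / (sqrt (K\<^sup>2 + x\<^sup>2) * (B + sqrt (K\<^sup>2 + x\<^sup>2))\<^sup>2)))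
          - y x * (2 * (a - 1) / x) * lommel_term0 a b x)"
        and g = "\<lambda>x. - (M x * (y x * lommel_F a b x))"])
    fix x :: real assume x: "x > 0"
    define s where "s = sqrt (K\<^sup>2 + x\<^sup>2)"
    have s: "s > 0" "B + s > 0" using s by (simp_all add: s_def)
    have s2: "x\<^sup>2 = s\<^sup>2 - K\<^sup>2" by (simp add: s_def)
    have "s > K" using K x by (auto simp: s_def intro!: real_less_rsqrt)
    define y' where "y' = 1 / (B + s) - x\<^sup>2 / (s * (B + s)\<^sup>2)"
    have y: "y x = x / (B + s)" "y x > 0" using s x by (simp_all add: y_def s_def)
    have "1 - (2 * (b - a) + 1 + 2 * (a - 1)) / x * y x - (y x)\<^sup>2 - y'
      = (s * (B + s)\<^sup>2 - (2 * b - 1) * (B + s) * s - x\<^sup>2 * s - (B + s) * s + x\<^sup>2) / (s * (B + s)\<^sup>2)"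
      using s x unfolding y y'_def by (simp add: divide_simps power2_eq_square) (simp add: algebra_simps)
    \<comment> \<open>The factored form shows the sign: s > K because x > 0, and both 2a - 2 and K
      are positive.\<close>
    also have "s * (B + s)\<^sup>2 - (2 * b - 1) * (B + s) * s - x\<^sup>2 * s - (B + s) * s + x\<^sup>2
                 = (s - K) * ((2 * a - 2) * s + K)"
      unfolding s2 B_def K_def by (simp add: field_simps power2_eq_square)
    also have "\<dots> / (s * (B + s)\<^sup>2) > 0"
      using s K \<open>s > K\<close> assms(1) by (intro divide_pos_pos mult_pos_pos add_pos_pos) auto
    finally have "0 < lommel_F a b x * (1 - (2 * (b - a) + 1 + 2 * (a - 1)) / x * y x - (y x)\<^sup>2 - y')"
      using lommel_F_pos[of a b x] assms(1) b x by simp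
    also have "\<dots> = lommel_F a b x * (1 - (2 * (b - a) + 1) / x * y x - (y x)\<^sup>2 - y')
                  - y x * (2 * (a - 1) / x) * lommel_F a b x"
      using x by (simp add: field_simps)
    also have "\<dots> \<le> lommel_F a b x * (1 - (2 * (b - a) + 1) / x * y x - (y x)\<^sup>2 - y')
                  - y x * (2 * (a - 1) / x) * lommel_term0 a b x"
      using lommel_term0_less[of a b x] assms(1) b x y(2) by (intro diff_left_mono mult_left_mono) auto
    finally have pos: "0 < \<dots>" .
    show "(N has_real_derivative M x * (lommel_F a b x * (1 - (2 * (b - a) + 1) / x * y x - (y x)\<^sup>2
          - (1 / (B + sqrt (K\<^sup>2 + x\<^sup>2)) - x\<^sup>2 / (sqrt (K\<^sup>2 + x\<^sup>2) * (B + sqrt (K\<^sup>2 + x\<^sup>2))\<^sup>2)))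
          - y x * (2 * (a - 1) / x) * lommel_term0 a b x)) (at x)"
      using Riccati_comparison_has_derivative[of x B K b a] x s
      unfolding N_def M_def y_def s_def by simp
    show "M x * (lommel_F a b x * (1 - (2 * (b - a) + 1) / x * y x - (y x)\<^sup>2
          - (1 / (B + sqrt (K\<^sup>2 + x\<^sup>2)) - x\<^sup>2 / (sqrt (K\<^sup>2 + x\<^sup>2) * (B + sqrt (K\<^sup>2 + x\<^sup>2))\<^sup>2)))
          - y x * (2 * (a - 1) / x) * lommel_term0 a b x) > 0"
      using M[OF x] pos unfolding y'_def s_def by (rule mult_pos_pos)
    have "0 < M x * lommel_F a (b + 1) x"
      using M[OF x] b assms(1) x by (intro mult_pos_pos lommel_F_pos) auto
    thus "- (M x * (y x * lommel_F a b x)) \<le> N x" by (simp add: N_def algebra_simps)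
  next
    have "((\<lambda>x. - ((M x * lommel_F a b x) * y x)) \<longlongrightarrow> - (0 * (0 / (B + K)))) (at_right 0)"
      unfolding M_def y_def using assms(1-3) B K b
      by (intro tendsto_intros Riccati_factor_tendsto_0 sqrt_sq_add_tendsto) auto
    thus "((\<lambda>x. - (M x * (y x * lommel_F a b x))) \<longlongrightarrow> 0) (at_right 0)" by (simp add: mult_ac)
  qed fact
  thus ?thesis using M[OF assms(4)] by (simp add: N_def y_def zero_less_mult_iff)
qed

section \<open>Asymptotic behaviour at infinity\<close>

lemma sinh_sums: "(\<lambda>k. x ^ (2 * k + 1) / fact (2 * k + 1)) sums sinh (x :: real)"
proof -
  have "(\<lambda>k. (\<lambda>n. if even n then 0 else x ^ n /\<^sub>R fact n) (2 * k + 1)) sums sinh x"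
    by (subst sums_mono_reindex) (auto simp: strict_mono_def sinh_converges elim!: oddE)
  thus ?thesis by (simp add: field_simps)
qed

lemma cosh_sums: "(\<lambda>k. x ^ (2 * k) / fact (2 * k)) sums cosh (x :: real)"
proof -
  have "(\<lambda>k. (\<lambda>n. if even n then x ^ n /\<^sub>R fact n else 0) (2 * k)) sums cosh x"
    by (subst sums_mono_reindex) (auto simp: strict_mono_def cosh_converges elim!: evenE)
  thus ?thesis by (simp add: field_simps)
qed

lemma rGamma_real_Suc: "rGamma (real k + a) = (real k + a) * rGamma (real (Suc k) + a)"
  using rGamma_plus1[of "real k + a"] by (simp add: add_ac)

lemma rGamma_real_pred: "rGamma (real k + (a - 1)) = (real k + a - 1) * rGamma (real k + a)"
  using rGamma_plus1[of "real k + (a - 1)"] by (simp add: add_diff_eq)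

text \<open>The induction step needs 4(k + a)(k + b) \<ge> (2k + 2)(2k + 3). Comparing the
  coefficients of k and the constants gives exactly a + b \<ge> 5/2 and ab \<ge> 3/2, for t the
  conditions \<mu> \<ge> -1/2 and (\<mu> + 3)^2 - \<nu>^2 \<ge> 6.\<close>

lemma rGamma_Suc_le:
  fixes a b :: real
  assumes "a > 0" "b > 0" "a * b \<ge> 3 / 2" "a + b \<ge> 5 / 2"
  shows "rGamma (real k + a) * rGamma (real k + b) * fact (2 * k + 1) \<le> 4 ^ k * (rGamma a * rGamma b)"
proof (induction k)
  case (Suc k)
  define p where "p = (real k + a) * (real k + b)"
  have p: "p > 0" using assms by (simp add: p_def add_nonneg_pos)
  have "(a + b) * real k \<ge> 5 / 2 * real k" using assms(4) by (rule mult_right_mono) simp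
  hence "4 * p \<ge> (2 * real k + 3) * (2 * real k + 2)"
    using assms(3) by (simp add: p_def algebra_simps)
  have "rGamma (real k + a) * rGamma (real k + b)
          = p * (rGamma (real (Suc k) + a) * rGamma (real (Suc k) + b))"
    unfolding p_def rGamma_real_Suc[of k a] rGamma_real_Suc[of k b] by (simp only: mult_ac)
  moreover define R where "R = rGamma (real (Suc k) + a) * rGamma (real (Suc k) + b)"
  ultimately have IH: "p * R * fact (2 * k + 1) \<le> 4 ^ k * (rGamma a * rGamma b)" using Suc by simp
  have R: "R \<ge> 0" unfolding R_def using assms by (intro mult_nonneg_nonneg rGamma_nonneg_real) auto
  have "fact (2 * Suc k + 1) = (2 * real k + 3) * (2 * real k + 2) * fact (2 * k + 1)"
    by (simp add: algebra_simps)
  hence "R * fact (2 * Suc k + 1) = (2 * real k + 3) * (2 * real k + 2) * (R * fact (2 * k + 1))"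
    by simp
  also have "\<dots> \<le> 4 * p * (R * fact (2 * k + 1))"
    using \<open>4 * p \<ge> _\<close> R by (intro mult_right_mono) auto
  also have "\<dots> \<le> 4 * (4 ^ k * (rGamma a * rGamma b))" using IH by simp
  finally show ?case by (simp add: R_def mult_ac)
qed simp

text \<open>Gives the lower bound x/sinh x for the share of the first term in the series. Dividing
  it by x yields the logarithmic derivative of tanh(x/2), which is how tanh enters the
  theorem.\<close>

lemma lommel_F_le_sinh:
  assumes "a > 0" "b > 0" "a * b \<ge> 3 / 2" "a + b \<ge> 5 / 2" "x > 0"
  shows "x * lommel_F a b x \<le> lommel_term0 a b x * sinh x"
proof -
  have "x * lommel_G a b ((x / 2)\<^sup>2) \<le> rGamma a * rGamma b * sinh x"
  proof (rule sums_le[OF _ sums_mult[OF lommel_G_sums] sums_mult[OF sinh_sums]])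
    fix k
    have "rGamma (real k + a) * rGamma (real k + b) \<le> 4 ^ k * (rGamma a * rGamma b) / fact (2 * k + 1)"
      using rGamma_Suc_le[OF assms(1-4), of k] by (simp add: pos_le_divide_eq)
    hence "rGamma (real k + a) * rGamma (real k + b) * (x * ((x / 2)\<^sup>2) ^ k)
             \<le> 4 ^ k * (rGamma a * rGamma b) / fact (2 * k + 1) * (x * ((x / 2)\<^sup>2) ^ k)"
      using assms(5) by (intro mult_right_mono) auto
    also have "\<dots> = rGamma a * rGamma b * (x ^ (2 * k + 1) / fact (2 * k + 1))"
      by (simp add: power_divide power_mult)
    finally show "x * (rGamma (real k + a) * rGamma (real k + b) * ((x / 2)\<^sup>2) ^ k)
        \<le> rGamma a * rGamma b * (x ^ (2 * k + 1) / fact (2 * k + 1))"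
      by (simp only: mult_ac)
  qed
  hence "(x / 2) powr (a + b - 2) * (x * lommel_G a b ((x / 2)\<^sup>2))
           \<le> (x / 2) powr (a + b - 2) * (rGamma a * rGamma b * sinh x)"
    by (rule mult_left_mono) simp
  thus ?thesis unfolding lommel_F_def lommel_term0_def by (simp add: mult_ac)
qed

text \<open>The function is I_(-1/2); its closed form fixes the constant 1/sqrt(2 pi) for the whole
  family. The coefficients agree by the duplication formula k! \<Gamma>(k + 1/2) = sqrt(pi)
  (2k)!/4^k, obtained here by induction.\<close>

lemma lommel_F_1_half:
  assumes "x > 0"
  shows "lommel_F 1 (1 / 2) x = (x / 2) powr (- (1 / 2)) * cosh x / sqrt pi"
proof -
  have R: "rGamma (real k + 1) * rGamma (real k + 1 / 2) = 4 ^ k / (fact (2 * k) * sqrt pi)" for k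
  proof (induction k)
    case 0
    show ?case by (simp add: rGamma_inverse_Gamma Gamma_one_half_real field_simps)
  next
    case (Suc k)
    define p where "p = (real k + 1) * (real k + 1 / 2)"
    define R where "R = rGamma (real (Suc k) + 1) * rGamma (real (Suc k) + 1 / 2)"
    have "4 ^ k / (fact (2 * k) * sqrt pi) = p * R"
      unfolding Suc[symmetric] rGamma_real_Suc[of k 1] rGamma_real_Suc[of k "1 / 2"] p_def R_def
      by (simp only: mult_ac)
    moreover have "p > 0" by (simp add: p_def)
    ultimately have "R = 4 ^ Suc k / (4 * p * fact (2 * k) * sqrt pi)" by (simp add: field_simps)
    also have "4 * p * fact (2 * k) = fact (2 * Suc k)" by (simp add: p_def field_simps)
    finally show ?case by (simp only: R_def)
  qed
  have "rGamma (real k + 1) * rGamma (real k + 1 / 2) * ((x / 2)\<^sup>2) ^ k = 1 / sqrt pi * (x ^ (2 * k) / fact (2 * k))" for k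
    unfolding R by (simp add: power_divide power_mult)
  hence "lommel_G 1 (1 / 2) ((x / 2)\<^sup>2) = 1 / sqrt pi * cosh x"
    using sums_mult[OF cosh_sums[of x], of "1 / sqrt pi"] lommel_G_sums[of 1 "1 / 2" "(x / 2)\<^sup>2"]
    by (simp add: sums_unique2)
  thus ?thesis by (simp add: lommel_F_def)
qed

section \<open>Asymptotic effect of shifting a parameter\<close>

text \<open>On [c, c + 1] the convex function ln \<Gamma> increases by ln c, and the chord bounds it
  in between.\<close>

lemma Gamma_add_le:
  fixes c \<delta> :: real
  assumes "c > 0" "0 \<le> \<delta>" "\<delta> \<le> 1"
  shows "Gamma (c + \<delta>) \<le> Gamma c * c powr \<delta>"
proof -
  have pos: "Gamma c > 0" "Gamma (c + 1) > 0" "Gamma (c + \<delta>) > 0" using assms by simp_all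
  have "(ln \<circ> Gamma) ((1 - \<delta>) *\<^sub>R c + \<delta> *\<^sub>R (c + 1)) \<le> (1 - \<delta>) * (ln \<circ> Gamma) c + \<delta> * (ln \<circ> Gamma) (c + 1)"
    using assms by (intro convex_onD[OF log_convex_Gamma_real]) auto
  moreover have "(1 - \<delta>) *\<^sub>R c + \<delta> *\<^sub>R (c + 1) = c + \<delta>" by (simp add: algebra_simps)
  moreover have "Gamma (c + 1) = c * Gamma c" using assms by (intro Gamma_plus1) auto
  hence "ln (Gamma (c + 1)) = ln c + ln (Gamma c)" using ln_mult_pos[OF assms(1) pos(1)] by simp
  ultimately have "ln (Gamma (c + \<delta>)) \<le> (1 - \<delta>) * ln (Gamma c) + \<delta> * (ln c + ln (Gamma c))"
    by simp
  hence "ln (Gamma (c + \<delta>)) \<le> ln (Gamma c) + \<delta> * ln c"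
    by (simp add: algebra_simps)
  also have "\<dots> = ln (Gamma c * c powr \<delta>)" using ln_mult_pos[OF pos(1), of "c powr \<delta>"] assms(1) by (simp add: ln_powr)
  finally show ?thesis using pos assms by simp
qed

text \<open>From (y/c)^\<delta> \<ge> 1 + \<delta> ln(y/c) \<ge> 1 + \<delta>(1 - c/y). A bound
  linear in c can be summed against the terms of the series. Both inequalities are equalities at c =
  y, which suits y = x/2, around which the dominant indices lie for large x.\<close>

lemma powr_mult_rGamma_add_ge:
  fixes c \<delta> y :: real
  assumes "c > 0" "0 \<le> \<delta>" "\<delta> \<le> 1" "y > 0"
  shows "rGamma c * (1 + \<delta> - \<delta> * c / y) \<le> y powr \<delta> * rGamma (c + \<delta>)"
proof -
  have pos: "Gamma c > 0" "Gamma (c + \<delta>) > 0" using assms by simp_all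
  have "ln (c / y) \<le> c / y - 1" using assms by (intro ln_le_minus_one) auto
  hence "1 + \<delta> - \<delta> * c / y \<le> 1 + \<delta> * ln (y / c)"
    using mult_left_mono[of "ln (c / y)" "c / y - 1" \<delta>] assms by (simp add: ln_div algebra_simps)
  also have "\<dots> \<le> (y / c) powr \<delta>"
    using assms exp_ge_add_one_self[of "\<delta> * ln (y / c)"] by (simp add: powr_def)
  finally have "rGamma c * (1 + \<delta> - \<delta> * c / y) \<le> rGamma c * (y / c) powr \<delta>"
    using pos by (intro mult_left_mono) (auto simp: rGamma_inverse_Gamma)
  also have "\<dots> = y powr \<delta> * (1 / (Gamma c * c powr \<delta>))"
    using assms by (simp add: powr_divide rGamma_inverse_Gamma field_simps)
  also have "\<dots> \<le> y powr \<delta> * (1 / Gamma (c + \<delta>))"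
    using Gamma_add_le[OF assms(1-3)] pos assms by (intro mult_left_mono divide_left_mono) auto
  finally show ?thesis by (simp add: rGamma_inverse_Gamma divide_inverse)
qed

context
  fixes a b x :: real
  assumes ab: "a > 0" "b > 0" and x: "x > 0"
begin

text \<open>The terms of \<open>lommel_F a b x\<close>, read as unnormalized weights on k. Their
  moments of order one and two, \<open>T_sums'\<close> and \<open>T_sums''\<close>, are again values
  of \<open>lommel_F\<close> with lowered parameters.\<close>

private definition T where
  "T = (\<lambda>k. (x / 2) powr (a + b - 2 + 2 * real k) * rGamma (real k + a) * rGamma (real k + b))"

private lemma T_nonneg: "T k \<ge> 0"
  unfolding T_def using ab by (intro mult_nonneg_nonneg rGamma_nonneg_real) auto

private lemma T_sums: "T sums lommel_F a b x"
  unfolding T_def by (rule lommel_F_sums[OF x])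

private lemma T_sums': "(\<lambda>k. (real k + b - 1) * T k) sums (x / 2 * lommel_F a (b - 1) x)"
proof -
  have "x / 2 * ((x / 2) powr (a + (b - 1) - 2 + 2 * real k) * rGamma (real k + a) * rGamma (real k + (b - 1)))
          = (real k + b - 1) * T k" for k
  proof -
    have "(x / 2) powr (a + b - 2 + 2 * real k) = (x / 2) powr (a + (b - 1) - 2 + 2 * real k) * (x / 2)"
      using x powr_add[of "x / 2" "a + (b - 1) - 2 + 2 * real k" 1] by (simp add: algebra_simps)
    thus ?thesis unfolding T_def rGamma_real_pred by (simp only: mult_ac)
  qed
  thus ?thesis using sums_mult[OF lommel_F_sums[OF x, of a "b - 1"], of "x / 2"] by simp
qed

private lemma T_sums'': "(\<lambda>k. (real k + a - 1) * (real k + b - 1) * T k) sums ((x / 2)\<^sup>2 * lommel_F (a - 1) (b - 1) x)"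
proof -
  have "(x / 2)\<^sup>2 * ((x / 2) powr (a - 1 + (b - 1) - 2 + 2 * real k) * rGamma (real k + (a - 1)) * rGamma (real k + (b - 1)))
          = (real k + a - 1) * (real k + b - 1) * T k" for k
  proof -
    have "(x / 2) powr (a + b - 2 + 2 * real k) = (x / 2) powr (a - 1 + (b - 1) - 2 + 2 * real k) * (x / 2)\<^sup>2"
      using x powr_add[of "x / 2" "a - 1 + (b - 1) - 2 + 2 * real k" 2]
      by (simp add: powr_numeral algebra_simps)
    thus ?thesis unfolding T_def rGamma_real_pred by (simp only: mult_ac)
  qed
  thus ?thesis using sums_mult[OF lommel_F_sums[OF x, of "a - 1" "b - 1"], of "(x / 2)\<^sup>2"] by simp
qed

text \<open>The linear bound is summed with y = x/2 and c = k + b. The known moment is that of k + b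
  - 1, and the remaining 1 produces the summand with 2/x.\<close>

lemma lommel_F_shift_ge:
  assumes \<delta>: "0 \<le> \<delta>" "\<delta> \<le> 1"
  shows "(1 + \<delta>) * lommel_F a b x - \<delta> * (lommel_F a (b - 1) x + 2 / x * lommel_F a b x) \<le> lommel_F a (b + \<delta>) x"
proof -
  have "(\<lambda>k. (1 + \<delta>) * T k - \<delta> * (2 / x) * ((real k + b - 1) * T k + T k))
           sums ((1 + \<delta>) * lommel_F a b x - \<delta> * (2 / x) * (x / 2 * lommel_F a (b - 1) x + lommel_F a b x))"
    by (intro sums_diff sums_mult sums_add T_sums T_sums')
  note sums = this
  have "(1 + \<delta>) * lommel_F a b x - \<delta> * (2 / x) * (x / 2 * lommel_F a (b - 1) x + lommel_F a b x) \<le> lommel_F a (b + \<delta>) x"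
  proof (rule sums_le[OF _ sums lommel_F_sums[OF x]])
    fix k
    define c where "c = real k + b"
    have "rGamma c * (1 + \<delta> - \<delta> * c / (x / 2)) \<le> (x / 2) powr \<delta> * rGamma (c + \<delta>)"
      using ab x \<delta> by (intro powr_mult_rGamma_add_ge) (auto simp: c_def)
    hence "(x / 2) powr (a + b - 2 + 2 * real k) * rGamma (real k + a) * (rGamma c * (1 + \<delta> - \<delta> * c / (x / 2)))
             \<le> (x / 2) powr (a + b - 2 + 2 * real k) * rGamma (real k + a) * ((x / 2) powr \<delta> * rGamma (c + \<delta>))"
      using ab by (intro mult_left_mono mult_nonneg_nonneg rGamma_nonneg_real) auto
    moreover have "(x / 2) powr (a + b - 2 + 2 * real k) * (x / 2) powr \<delta> = (x / 2) powr (a + (b + \<delta>) - 2 + 2 * real k)"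
      by (subst powr_add[symmetric]) (simp add: algebra_simps)
    ultimately show "(1 + \<delta>) * T k - \<delta> * (2 / x) * ((real k + b - 1) * T k + T k)
       \<le> (x / 2) powr (a + (b + \<delta>) - 2 + 2 * real k) * rGamma (real k + a) * rGamma (real k + (b + \<delta>))"
      using x by (simp add: T_def c_def field_simps)
  qed
  thus ?thesis using x by (simp add: field_simps)
qed

text \<open>Bounds the first moment by the second.\<close>

lemma lommel_F_pred_le:
  "x * lommel_F a (b - 1) x \<le> x / 2 * (lommel_F (a - 1) (b - 1) x + lommel_F a b x) + (b - a) * lommel_F a (b - 1) x"
proof -
  have "(\<lambda>k. 2 / x * ((real k + a - 1) * (real k + b - 1) * T k) + x / 2 * T k + 2 / x * (b - a) * ((real k + b - 1) * T k))
           sums (2 / x * ((x / 2)\<^sup>2 * lommel_F (a - 1) (b - 1) x) + x / 2 * lommel_F a b x + 2 / x * (b - a) * (x / 2 * lommel_F a (b - 1) x))"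
    by (intro sums_mult sums_add T_sums T_sums' T_sums'')
  with sums_mult[OF T_sums', of 2]
  have "2 * (x / 2 * lommel_F a (b - 1) x) \<le> 2 / x * ((x / 2)\<^sup>2 * lommel_F (a - 1) (b - 1) x) + x / 2 * lommel_F a b x + 2 / x * (b - a) * (x / 2 * lommel_F a (b - 1) x)"
  proof (rule sums_le[rotated])
    fix k
    define c where "c = real k + b - 1"
    \<comment> \<open>Completing the square bounds 2c by c^2/(x/2) + x/2, and c^2 = (k + a - 1) c +
      (b - a) c reduces the square to the known moments.\<close>
    have "0 \<le> (c - x / 2)\<^sup>2 / (x / 2)" using x by simp
    hence "2 * c \<le> c * c / (x / 2) + x / 2"
      using x by (simp add: field_simps power2_eq_square)
    also have "\<dots> = 2 / x * ((real k + a - 1) * c) + x / 2 + 2 / x * (b - a) * c"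
      using x by (simp add: c_def field_simps)
    finally have "2 * c * T k \<le> (2 / x * ((real k + a - 1) * c) + x / 2 + 2 / x * (b - a) * c) * T k"
      using T_nonneg by (rule mult_right_mono)
    thus "2 * ((real k + b - 1) * T k) \<le> 2 / x * ((real k + a - 1) * (real k + b - 1) * T k) + x / 2 * T k + 2 / x * (b - a) * ((real k + b - 1) * T k)"
      unfolding c_def by (simp only: distrib_right mult.assoc)
  qed
  moreover have "2 / x * ((x / 2)\<^sup>2 * lommel_F (a - 1) (b - 1) x) = x / 2 * lommel_F (a - 1) (b - 1) x"
    and "2 / x * (b - a) * (x / 2 * lommel_F a (b - 1) x) = (b - a) * lommel_F a (b - 1) x"
    using x by (simp_all add: field_simps power2_eq_square)
  ultimately show ?thesis by (simp add: algebra_simps)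
qed

end

text \<open>The k = 1 term already grows like x^(a + b). This is enough to discard the single terms
  of order x^(a + b - 4) and x^(a + b - 3) that the recurrence leaves over.\<close>

lemma powr_div_lommel_F_tendsto_0:
  assumes "a > 0" "b > 0" "p < a + b"
  shows "((\<lambda>x. (x / 2) powr p / lommel_F a b x) \<longlongrightarrow> 0) at_top"
proof (rule tendsto_sandwich[of "\<lambda>_. 0" _ _ "\<lambda>x. (x / 2) powr (p - (a + b)) / (rGamma (a + 1) * rGamma (b + 1))"])
  have "eventually (\<lambda>x::real. x > 0) at_top" by (rule eventually_gt_at_top)
  thus "eventually (\<lambda>x. 0 \<le> (x / 2) powr p / lommel_F a b x) at_top"
    by eventually_elim (use lommel_F_pos[of a b] assms in \<open>auto simp: less_imp_le\<close>)
  have "eventually (\<lambda>x::real. x > 0) at_top" by (rule eventually_gt_at_top)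
  thus "eventually (\<lambda>x. (x / 2) powr p / lommel_F a b x \<le> (x / 2) powr (p - (a + b)) / (rGamma (a + 1) * rGamma (b + 1))) at_top"
  proof eventually_elim
    case (elim x)
    have 1: "lommel_term0 (a + 1) (b + 1) x > 0" using assms elim by (intro lommel_term0_pos) auto
    have "lommel_term0 (a + 1) (b + 1) x \<le> lommel_F (a + 1) (b + 1) x"
      using assms elim by (intro less_imp_le[OF lommel_term0_less]) auto
    also have "\<dots> \<le> lommel_F a b x"
      using lommel_F_eq_term0[OF elim, of a b] lommel_term0_pos[of a b x] assms elim by linarith
    finally have "(x / 2) powr p / lommel_F a b x \<le> (x / 2) powr p / lommel_term0 (a + 1) (b + 1) x"
      using 1 by (intro divide_left_mono mult_pos_pos) auto
    thus ?case by (simp add: lommel_term0_def powr_diff)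
  qed
  have "((\<lambda>x::real. (x / 2) powr (p - (a + b))) \<longlongrightarrow> 0) at_top" using assms by real_asymp
  from tendsto_divide[OF this tendsto_const[of "rGamma (a + 1) * rGamma (b + 1)"]] assms
  show "((\<lambda>x. (x / 2) powr (p - (a + b)) / (rGamma (a + 1) * rGamma (b + 1))) \<longlongrightarrow> 0) at_top"
    using rGamma_pos_real[of "a + 1"] rGamma_pos_real[of "b + 1"] by simp
qed simp_all

text \<open>
  \<^term>\<open>lommel_F a (b - 1) x / lommel_F a b x\<close> is the mean of \<^term>\<open>(k + b - 1) / (x / 2)\<close>, where \<^term>\<open>k\<close> is weighted by
  the terms of the series; its second moment is computed by the recurrence.
\<close>

lemma lommel_F_pred_div_upper:
  assumes "a > 0" "b > 0"
  obtains u where "(u \<longlongrightarrow> 1) at_top" "eventually (\<lambda>x. lommel_F a (b - 1) x / lommel_F a b x \<le> u x) at_top"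
proof
  define w where "w = (\<lambda>x. (x / 2) powr (a + b - 4) / lommel_F a b x * (rGamma (a - 1) * rGamma (b - 1)))"
  have "(w \<longlongrightarrow> 0 * (rGamma (a - 1) * rGamma (b - 1))) at_top"
    unfolding w_def using assms by (intro tendsto_intros powr_div_lommel_F_tendsto_0) auto
  hence w: "(w \<longlongrightarrow> 0) at_top" by simp
  have "((\<lambda>x. x / (2 * (x - (b - a)))) \<longlongrightarrow> 1 / 2) at_top" by real_asymp
  from tendsto_mult[OF this tendsto_add[OF w tendsto_const[of 2]]]
  show "((\<lambda>x. x / (2 * (x - (b - a))) * (w x + 2)) \<longlongrightarrow> 1) at_top" by simp
  have "eventually (\<lambda>x. x > max 0 (b - a)) at_top" by (rule eventually_gt_at_top)
  thus "eventually (\<lambda>x. lommel_F a (b - 1) x / lommel_F a b x \<le> x / (2 * (x - (b - a))) * (w x + 2)) at_top"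
  proof eventually_elim
    case (elim x)
    hence x: "x > 0" "x - (b - a) > 0" by auto
    have F: "lommel_F a b x > 0" using assms x by (intro lommel_F_pos) auto
    have "lommel_F (a - 1) (b - 1) x = w x * lommel_F a b x + lommel_F a b x"
      using lommel_F_recurrence[OF x(1), of "a - 1" "b - 1"] F by (simp add: w_def algebra_simps)
    hence "(x - (b - a)) * lommel_F a (b - 1) x \<le> x / 2 * (w x + 2) * lommel_F a b x"
      using lommel_F_pred_le[OF assms x(1)] by (simp add: algebra_simps)
    thus ?case using F x(2) by (simp add: field_simps)
  qed
qed

text \<open>The lower bound is the upper bound with the parameters exchanged: up to one negligible
  term \<open>lommel_F a (b - 1)\<close> equals \<open>lommel_F (a + 1) b\<close>, and
  \<open>lommel_F a b / lommel_F (a + 1) b\<close> is again a quotient with one parameter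
  lowered.\<close>

lemma lommel_F_pred_div_tendsto:
  assumes "a > 0" "b > 0"
  shows "((\<lambda>x. lommel_F a (b - 1) x / lommel_F a b x) \<longlongrightarrow> 1) at_top"
proof -
  obtain u where u: "(u \<longlongrightarrow> 1) at_top" "eventually (\<lambda>x. lommel_F a (b - 1) x / lommel_F a b x \<le> u x) at_top"
    using lommel_F_pred_div_upper[OF assms] .
  have "a + 1 > 0" using assms by simp
  obtain v where v: "(v \<longlongrightarrow> 1) at_top"
      "eventually (\<lambda>x. lommel_F b (a + 1 - 1) x / lommel_F b (a + 1) x \<le> v x) at_top"
    using lommel_F_pred_div_upper[OF assms(2) \<open>a + 1 > 0\<close>] .
  define w where "w = (\<lambda>x. (x / 2) powr (a + b - 3) / lommel_F a b x * (rGamma a * rGamma (b - 1)))"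
  have "(w \<longlongrightarrow> 0 * (rGamma a * rGamma (b - 1))) at_top"
    unfolding w_def using assms by (intro tendsto_intros powr_div_lommel_F_tendsto_0) auto
  hence w: "(w \<longlongrightarrow> 0) at_top" by simp
  show ?thesis
  proof (rule tendsto_sandwich[of "\<lambda>x. w x + 1 / v x" _ _ u])
    show "((\<lambda>x. w x + 1 / v x) \<longlongrightarrow> 1) at_top"
      using tendsto_add[OF w tendsto_divide[OF tendsto_const[of 1] v(1)]] by simp
    show "eventually (\<lambda>x. w x + 1 / v x \<le> lommel_F a (b - 1) x / lommel_F a b x) at_top"
      using v(2) eventually_gt_at_top[of 0]
    proof eventually_elim
      case (elim x)
      have F: "lommel_F a b x > 0" "lommel_F (a + 1) b x > 0"
        using assms elim by (auto intro!: lommel_F_pos)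
      have "lommel_F a b x / lommel_F (a + 1) b x \<le> v x"
        using elim(1) lommel_F_commute[of b] by simp
      hence "1 / v x \<le> 1 / (lommel_F a b x / lommel_F (a + 1) b x)"
        using F by (intro divide_left_mono mult_pos_pos) (auto intro: less_le_trans[OF divide_pos_pos])
      moreover have "lommel_F a (b - 1) x = w x * lommel_F a b x + lommel_F (a + 1) b x"
        using lommel_F_recurrence[OF elim(2), of a "b - 1"] F by (simp add: w_def algebra_simps)
      ultimately show ?case using F by (simp add: field_simps)
    qed
  qed (use u in auto)
qed

text \<open>\<open>lommel_F_shift_ge\<close> only bounds from below, so it is used twice: for the
  step from b to b + \<delta>, and for the remaining step from b + \<delta> to b + 1, whose end
  point is already compared with b. The second use bounds the quotient from above.\<close>

lemma lommel_F_shift_asymp_equiv: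
  assumes "a > 0" "b > 0" "0 \<le> \<delta>" "\<delta> \<le> 1"
  shows "lommel_F a (b + \<delta>) \<sim>[at_top] lommel_F a b"
proof -
  have lower: "((\<lambda>x. 1 + d - d * (lommel_F a (c - 1) x / lommel_F a c x + 2 / x)) \<longlongrightarrow> 1) at_top"
    if "c > 0" for c d :: real
  proof -
    have "((\<lambda>x::real. 2 / x) \<longlongrightarrow> 0) at_top" by real_asymp
    hence "((\<lambda>x. 1 + d - d * (lommel_F a (c - 1) x / lommel_F a c x + 2 / x)) \<longlongrightarrow> 1 + d - d * (1 + 0)) at_top"
      using assms(1) that by (intro tendsto_intros lommel_F_pred_div_tendsto) auto
    thus ?thesis by simp
  qed
  have lower': "eventually (\<lambda>x. 1 + d - d * (lommel_F a (c - 1) x / lommel_F a c x + 2 / x)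
                  \<le> lommel_F a (c + d) x / lommel_F a c x) at_top"
    if "c > 0" "0 \<le> d" "d \<le> 1" for c d :: real
    using eventually_gt_at_top[of 0]
  proof eventually_elim
    case (elim x)
    have F: "lommel_F a c x > 0" using assms(1) that elim by (intro lommel_F_pos) auto
    have "((1 + d) * lommel_F a c x - d * (lommel_F a (c - 1) x + 2 / x * lommel_F a c x)) / lommel_F a c x
            \<le> lommel_F a (c + d) x / lommel_F a c x"
      using lommel_F_shift_ge[OF assms(1) that(1) elim that(2,3)] F by (intro divide_right_mono) auto
    also have "((1 + d) * lommel_F a c x - d * (lommel_F a (c - 1) x + 2 / x * lommel_F a c x)) / lommel_F a c x
        = 1 + d - d * (lommel_F a (c - 1) x / lommel_F a c x + 2 / x)"
      using F elim by (simp add: field_simps)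
    finally show ?case .
  qed
  have bd: "b + \<delta> > 0" using assms by simp
  define l where "l = (\<lambda>x. 1 + (1 - \<delta>) - (1 - \<delta>) * (lommel_F a (b + \<delta> - 1) x / lommel_F a (b + \<delta>) x + 2 / x))"
  have l: "(l \<longlongrightarrow> 1) at_top" "eventually (\<lambda>x. l x \<le> lommel_F a (b + 1) x / lommel_F a (b + \<delta>) x) at_top"
    using lower[OF bd, of "1 - \<delta>"] lower'[OF bd, of "1 - \<delta>"] assms unfolding l_def by simp_all
  have "((\<lambda>x. 1 / (lommel_F a (b + 1 - 1) x / lommel_F a (b + 1) x)) \<longlongrightarrow> 1 / 1) at_top"
    using assms by (intro tendsto_divide lommel_F_pred_div_tendsto tendsto_const) auto
  hence Suc: "((\<lambda>x. lommel_F a (b + 1) x / lommel_F a b x) \<longlongrightarrow> 1) at_top" by simp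
  show ?thesis
  proof (intro asymp_equivI' tendsto_sandwich[OF lower'[OF assms(2-4)] _ lower[OF assms(2)]])
    show "((\<lambda>x. (lommel_F a (b + 1) x / lommel_F a b x) / l x) \<longlongrightarrow> 1) at_top"
      using tendsto_divide[OF Suc l(1)] by simp
    have "eventually (\<lambda>x. l x > 0) at_top" using l(1) by (rule order_tendstoD) simp
    thus "eventually (\<lambda>x. lommel_F a (b + \<delta>) x / lommel_F a b x \<le> (lommel_F a (b + 1) x / lommel_F a b x) / l x) at_top"
      using l(2) eventually_gt_at_top[of 0]
    proof eventually_elim
      case (elim x)
      have "lommel_F a (b + \<delta>) x > 0" "lommel_F a b x > 0"
        using assms elim(3) by (auto intro!: lommel_F_pos)
      thus ?case using elim by (simp add: field_simps)
    qed
  qed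
qed

lemma lommel_F_asymp_equiv_right:
  assumes "a > 0" "b > 0" "d > 0"
  shows "lommel_F a b \<sim>[at_top] lommel_F a d"
proof -
  have *: "lommel_F a (b + real n) \<sim>[at_top] lommel_F a b" if "b > 0" for b n
  proof (induction n)
    case (Suc n)
    have "lommel_F a (b + real n + 1) \<sim>[at_top] lommel_F a (b + real n)"
      using assms(1) that by (intro lommel_F_shift_asymp_equiv) auto
    from asymp_equiv_trans[OF this Suc] show ?case by (simp add: add_ac)
  qed simp
  have "lommel_F a d \<sim>[at_top] lommel_F a b" if "b > 0" "b \<le> d" for b d
  proof -
    \<comment> \<open>Integer part of the shift; the remainder lies in [0, 1], where the
      log-convexity bound applies.\<close>
    define n where "n = nat \<lfloor>d - b\<rfloor>"
    have n: "real n \<le> d - b" "d - b \<le> real n + 1" using that unfolding n_def by linarith+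
    have "lommel_F a (b + real n + (d - b - real n)) \<sim>[at_top] lommel_F a (b + real n)"
      using assms(1) that n by (intro lommel_F_shift_asymp_equiv) auto
    from asymp_equiv_trans[OF this *[OF that(1)]] show ?thesis by simp
  qed
  thus ?thesis using assms by (metis asymp_equiv_sym linear)
qed

lemma lommel_F_asymp_equiv:
  assumes "a > 0" "b > 0" "c > 0" "d > 0"
  shows "lommel_F a b \<sim>[at_top] lommel_F c d"
proof -
  have comm: "lommel_F a d = lommel_F d a" for a d using lommel_F_commute by blast
  have "lommel_F a b \<sim>[at_top] lommel_F a d" using assms by (intro lommel_F_asymp_equiv_right)
  also have "lommel_F a d \<sim>[at_top] lommel_F c d"
    unfolding comm[of _ d] using assms by (intro lommel_F_asymp_equiv_right)
  finally show ?thesis .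
qed

lemma lommel_F_div_tendsto:
  assumes "a > 0" "b > 0" "c > 0" "d > 0"
  shows "((\<lambda>x. lommel_F a b x / lommel_F c d x) \<longlongrightarrow> 1) at_top"
proof (rule asymp_equivD_strong[OF lommel_F_asymp_equiv[OF assms]])
  show "eventually (\<lambda>x. lommel_F a b x \<noteq> 0 \<or> lommel_F c d x \<noteq> 0) at_top"
    using eventually_gt_at_top[of 0]
    by eventually_elim (use lommel_F_pos[of a b] assms in fastforce)
qed

lemma lommel_F_sqrt_exp_tendsto:
  assumes "a > 0" "b > 0"
  shows "((\<lambda>x. lommel_F a b x * sqrt x * exp (- x)) \<longlongrightarrow> 1 / sqrt (2 * pi)) at_top"
proof -
  have "((\<lambda>x::real. exp (- (2 * x))) \<longlongrightarrow> 0) at_top" by real_asymp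
  hence "((\<lambda>x. lommel_F a b x / lommel_F 1 (1 / 2) x * (1 / sqrt (2 * pi) * (1 + exp (- (2 * x)))))
          \<longlongrightarrow> 1 * (1 / sqrt (2 * pi) * (1 + 0))) at_top"
    using assms by (intro tendsto_mult tendsto_add tendsto_const lommel_F_div_tendsto) auto
  moreover have "eventually (\<lambda>x. lommel_F a b x / lommel_F 1 (1 / 2) x * (1 / sqrt (2 * pi) * (1 + exp (- (2 * x))))
                   = lommel_F a b x * sqrt x * exp (- x)) at_top"
    using eventually_gt_at_top[of 0]
  proof eventually_elim
    case (elim x)
    have P: "(x / 2) powr (- (1 / 2)) = sqrt 2 / sqrt x"
      using elim by (simp add: powr_minus powr_half_sqrt real_sqrt_divide)
    have "lommel_F 1 (1 / 2) x * sqrt x * exp (- x) = sqrt 2 * (exp x * exp (- x) + exp (- x) * exp (- x)) / (2 * sqrt pi)"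
      using elim unfolding lommel_F_1_half[OF elim] cosh_def P by (simp add: field_simps)
    also have "\<dots> = sqrt 2 / (sqrt 2 * sqrt 2 * sqrt pi) * (1 + exp (- (2 * x)))"
      by (simp flip: exp_add)
    also have "\<dots> = 1 / sqrt (2 * pi) * (1 + exp (- (2 * x)))"
      by (simp add: real_sqrt_mult del: real_sqrt_mult_self)
    finally have "1 / sqrt (2 * pi) * (1 + exp (- (2 * x))) = lommel_F 1 (1 / 2) x * sqrt x * exp (- x)" by simp
    moreover have "lommel_F 1 (1 / 2) x > 0" using elim by (intro lommel_F_pos) auto
    ultimately show ?case by (simp only:) simp
  qed
  ultimately show ?thesis by (auto intro: Lim_transform_eventually)
qed

section \<open>Logarithmic derivatives and monotone quotients\<close>

text \<open>Positivity is part of the notion, so no logarithm has to be formed and the sign of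
  \<phi> alone decides monotonicity; products, quotients and powers become sums, differences and
  multiples of \<phi>.\<close>

definition log_deriv :: "(real \<Rightarrow> real) \<Rightarrow> (real \<Rightarrow> real) \<Rightarrow> bool" where
  "log_deriv f \<phi> \<longleftrightarrow> (\<forall>x>0. f x > 0 \<and> (f has_real_derivative f x * \<phi> x) (at x))"

lemma log_deriv_pos: "log_deriv f \<phi> \<Longrightarrow> x > 0 \<Longrightarrow> f x > 0"
  by (simp add: log_deriv_def)

lemma log_deriv_mult:
  "log_deriv f \<phi> \<Longrightarrow> log_deriv g \<psi> \<Longrightarrow> log_deriv (\<lambda>x. f x * g x) (\<lambda>x. \<phi> x + \<psi> x)"
  unfolding log_deriv_def
  by (auto intro!: derivative_eq_intros simp: algebra_simps)

lemma log_deriv_divide: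
  assumes "log_deriv f \<phi>" "log_deriv g \<psi>"
  shows "log_deriv (\<lambda>x. f x / g x) (\<lambda>x. \<phi> x - \<psi> x)"
  unfolding log_deriv_def
proof safe
  fix x :: real assume x: "x > 0"
  have pos: "f x > 0" "g x > 0" and d: "(f has_real_derivative f x * \<phi> x) (at x)" "(g has_real_derivative g x * \<psi> x) (at x)"
    using assms x by (auto simp: log_deriv_def)
  show "f x / g x > 0" using pos by simp
  show "((\<lambda>x. f x / g x) has_real_derivative f x / g x * (\<phi> x - \<psi> x)) (at x)"
    by (rule DERIV_cong[OF DERIV_divide[OF d]]) (use pos in \<open>auto simp: field_simps\<close>)
qed

lemma log_deriv_powr: "log_deriv f \<phi> \<Longrightarrow> log_deriv (\<lambda>x. f x powr c) (\<lambda>x. c * \<phi> x)"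
  unfolding log_deriv_def
  by (auto intro!: DERIV_cong[OF has_real_derivative_powr_const])

lemma log_deriv_ident: "log_deriv (\<lambda>x. x) (\<lambda>x. 1 / x)"
  by (auto simp: log_deriv_def)

lemma log_deriv_add_power2: "A > 0 \<Longrightarrow> log_deriv (\<lambda>x. A + x\<^sup>2) (\<lambda>x. 2 * x / (A + x\<^sup>2))"
  unfolding log_deriv_def
  by (auto intro!: derivative_eq_intros add_pos_nonneg simp: add_pos_nonneg[THEN less_imp_neq, symmetric])

lemma log_deriv_tanh_half: "log_deriv (\<lambda>x. tanh (x / 2)) (\<lambda>x. 1 / sinh x)"
  unfolding log_deriv_def
proof safe
  fix x :: real assume x: "x > 0"
  show "tanh (x / 2) > 0" using x by simp
  have sc: "sinh (x / 2) > 0" "cosh (x / 2) > 0" using x by simp_all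
  have s: "sinh x = 2 * sinh (x / 2) * cosh (x / 2)" using sinh_double[of "x / 2"] by simp
  have cs: "(cosh (x / 2))\<^sup>2 - (sinh (x / 2))\<^sup>2 = 1" using cosh_square_eq[of "x / 2"] by linarith
  have "1 - (tanh (x / 2))\<^sup>2 = 1 / (cosh (x / 2))\<^sup>2"
  proof -
    have "1 - (tanh (x / 2))\<^sup>2 = ((cosh (x / 2))\<^sup>2 - (sinh (x / 2))\<^sup>2) / (cosh (x / 2))\<^sup>2"
      using sc by (simp add: tanh_def power_divide diff_divide_distrib)
    thus ?thesis by (simp only: cs)
  qed
  hence "(1 - (tanh (x / 2))\<^sup>2) * (1 / 2) = tanh (x / 2) * (1 / sinh x)"
    unfolding s using sc by (simp add: tanh_def power2_eq_square)
  moreover have "((\<lambda>x. tanh (x / 2)) has_real_derivative (1 - (tanh (x / 2))\<^sup>2) * (1 / 2)) (at x)"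
    using sc by (auto intro!: derivative_eq_intros)
  ultimately show "((\<lambda>x. tanh (x / 2)) has_real_derivative tanh (x / 2) * (1 / sinh x)) (at x)" by simp
qed

lemma log_deriv_exp_sqrt_powr:
  assumes "B \<ge> 0"
  shows "log_deriv (\<lambda>x. exp (sqrt (K\<^sup>2 + x\<^sup>2)) * (B + sqrt (K\<^sup>2 + x\<^sup>2)) powr (- B))
           (\<lambda>x. x / (B + sqrt (K\<^sup>2 + x\<^sup>2)))"
  unfolding log_deriv_def
proof safe
  fix x :: real assume x: "x > 0"
  have "sqrt (K\<^sup>2 + x\<^sup>2) > 0" using x by (simp add: add_nonneg_pos)
  hence pos: "B + sqrt (K\<^sup>2 + x\<^sup>2) > 0" using assms by linarith
  thus "exp (sqrt (K\<^sup>2 + x\<^sup>2)) * (B + sqrt (K\<^sup>2 + x\<^sup>2)) powr (- B) > 0" by simp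
  show "((\<lambda>x. exp (sqrt (K\<^sup>2 + x\<^sup>2)) * (B + sqrt (K\<^sup>2 + x\<^sup>2)) powr (- B)) has_real_derivative
          exp (sqrt (K\<^sup>2 + x\<^sup>2)) * (B + sqrt (K\<^sup>2 + x\<^sup>2)) powr (- B) * (x / (B + sqrt (K\<^sup>2 + x\<^sup>2)))) (at x)"
    using x pos by (rule exp_sqrt_powr_has_derivative)
qed

lemma log_deriv_lommel_F:
  assumes "a > 0" "b \<ge> 0"
  shows "log_deriv (lommel_F a b) (\<lambda>x. (b - a) / x + lommel_F (a - 1) b x / lommel_F a b x)"
  unfolding log_deriv_def
proof safe
  fix x :: real assume x: "x > 0"
  show pos: "lommel_F a b x > 0" using assms x by (intro lommel_F_pos)
  show "(lommel_F a b has_real_derivative lommel_F a b x * ((b - a) / x + lommel_F (a - 1) b x / lommel_F a b x)) (at x)"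
    by (rule DERIV_cong[OF lommel_F_has_derivative[OF x]]) (use pos in \<open>simp add: algebra_simps\<close>)
qed

lemma log_deriv_decreasing:
  assumes "log_deriv f \<phi>" "\<And>x. x > 0 \<Longrightarrow> \<phi> x < 0" "0 < x" "x < y"
  shows "f y < f x"
proof (rule DERIV_neg_imp_decreasing[where f = f])
  fix u assume "x \<le> u"
  hence "u > 0" using assms by simp
  thus "\<exists>d. (f has_real_derivative d) (at u) \<and> d < 0"
    using assms(1,2) unfolding log_deriv_def by (meson mult_pos_neg)
qed fact

lemma log_deriv_nonincreasing:
  assumes "log_deriv f \<phi>" "\<And>x. x > 0 \<Longrightarrow> \<phi> x \<le> 0" "0 < x" "x \<le> y"
  shows "f y \<le> f x"
proof (rule DERIV_nonpos_imp_nonincreasing[where f = f])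
  fix u assume "x \<le> u"
  hence "u > 0" using assms by simp
  thus "\<exists>d. (f has_real_derivative d) (at u) \<and> d \<le> 0"
    using assms(1,2) unfolding log_deriv_def by (meson less_imp_le mult_nonneg_nonpos)
qed fact

lemma nonincreasing_ge_limit:
  fixes f :: "real \<Rightarrow> real"
  assumes "\<And>x y. 0 < x \<Longrightarrow> x < y \<Longrightarrow> f y \<le> f x" "(f \<longlongrightarrow> l) at_top" "x > 0"
  shows "l \<le> f x"
proof (rule tendsto_upperbound[OF assms(2)])
  show "eventually (\<lambda>y. f y \<le> f x) at_top"
    using eventually_gt_at_top[of x] by eventually_elim (simp add: assms(1,3))
qed simp

lemma decreasing_gt_limit:
  fixes f :: "real \<Rightarrow> real"
  assumes decr: "\<And>x y. 0 < x \<Longrightarrow> x < y \<Longrightarrow> f y < f x" and "(f \<longlongrightarrow> l) at_top" "x > 0"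
  shows "l < f x"
proof -
  have "l \<le> f (x + 1)"
  proof (rule nonincreasing_ge_limit[where f = f])
    show "f v \<le> f u" if "0 < u" "u < v" for u v using decr[OF that] by simp
  qed (use assms(2,3) in simp_all)
  also have "\<dots> < f x" using assms(3) by (intro decr) auto
  finally show ?thesis .
qed

lemma decreasing_less_limit:
  fixes f :: "real \<Rightarrow> real"
  assumes decr: "\<And>x y. 0 < x \<Longrightarrow> x < y \<Longrightarrow> f y < f x" and "(f \<longlongrightarrow> l) (at_right 0)" "x > 0"
  shows "f x < l"
proof -
  have "f x < f (x / 2)" using assms(3) by (intro decr) auto
  also have "f (x / 2) \<le> l"
  proof (rule tendsto_lowerbound[OF assms(2)])
    have "eventually (\<lambda>u. u < x / 2) (at_right 0)" "eventually (\<lambda>u::real. u > 0) (at_right 0)"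
      using \<open>x > 0\<close> by real_asymp+
    thus "eventually (\<lambda>u. f (x / 2) \<le> f u) (at_right 0)"
      by eventually_elim (simp add: decr less_imp_le)
  qed simp
  finally show ?thesis .
qed

lemma ratio_less_cross:
  fixes p q r s :: real
  assumes "p / q < r / s" "p > 0" "q > 0" "r > 0" "s > 0"
  shows "s / r < q / p"
  using assms by (simp add: field_simps)

text \<open>Joins the quotient comparison for the main part with the two-term bound for the first
  term. For t this bounds t'/t - I'/I from above, since both logarithmic derivatives contain the
  same \<nu>/x.\<close>

lemma lommel_log_deriv_less:
  assumes "a > 1" "b \<ge> a - 1" "x > 0"
  shows "lommel_F (a - 1) b x / lommel_F a b x
         < lommel_F 1 (b - a + 2) x / lommel_F 1 (b - a + 1) x + 2 * (a - 1) / x * (4 * a * b / (4 * a * b + x\<^sup>2))"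
proof -
  have b: "b > 0" using assms by simp
  have pos: "lommel_F a b x > 0" "lommel_F 1 (b - a + 1) x > 0"
    using assms b by (auto intro!: lommel_F_pos)
  have "lommel_F a (b + 1) x / lommel_F a b x < lommel_F 1 (b - a + 2) x / lommel_F 1 (b - a + 1) x"
    using lommel_ratio_less_Bessel_ratio[OF assms] pos by (simp add: field_simps)
  moreover have "4 * a * b + x\<^sup>2 > 0" using assms b by (intro add_pos_nonneg) auto
  hence "lommel_term0 a b x / lommel_F a b x \<le> 4 * a * b / (4 * a * b + x\<^sup>2)"
    using lommel_term0_le[of a b x] assms b pos by (simp add: field_simps)
  hence "2 * (a - 1) / x * (lommel_term0 a b x / lommel_F a b x) \<le> 2 * (a - 1) / x * (4 * a * b / (4 * a * b + x\<^sup>2))"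
    using assms by (intro mult_left_mono) auto
  ultimately show ?thesis
    unfolding lommel_F_eq_Suc[OF assms(3)] by (simp add: add_divide_distrib)
qed

section \<open>Comparison of the Lommel function with the Bessel function\<close>

context
  fixes \<mu> \<nu> :: real
  assumes \<nu>: "-1 \<le> \<nu>" "\<nu> < \<mu> + 1"
begin

private definition a where "a = (\<mu> - \<nu> + 3) / 2"
private definition b where "b = (\<mu> + \<nu> + 3) / 2"
private definition A where "A = (\<mu> + 3)\<^sup>2 - \<nu>\<^sup>2"
private definition t where "t = lommel_F a b"
private definition I where "I = lommel_F 1 (\<nu> + 1)"
text \<open>One function carries the lower quotient bound and both constants: it decreases, and for
  \<nu> > -1 it does so from \<open>Lommel_C\<close> at 0 to 1 at infinity.\<close>

private definition H where "H = (\<lambda>x. (x\<^sup>2 / (A + x\<^sup>2)) powr (- ((\<mu> - \<nu> + 1) / 2)) * t x / I x)"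

private lemma ab: "a > 1" "b \<ge> a - 1" "b > 0"
  using \<nu> by (auto simp: a_def b_def field_simps)

private lemma ab_eq: "b - a = \<nu>" "b - a + 1 = \<nu> + 1" "b - a + 2 = \<nu> + 2"
    "a + b = \<mu> + 3" "2 * (a - 1) = \<mu> - \<nu> + 1"
  using \<nu> by (auto simp: a_def b_def field_simps)

private lemma A: "A = 4 * a * b" "A > 0"
proof -
  show "A = 4 * a * b" unfolding A_def a_def b_def by (simp add: field_simps power2_eq_square)
  thus "A > 0" using ab by simp
qed

private lemma t_pos: "x > 0 \<Longrightarrow> t x > 0"
  unfolding t_def using ab by (intro lommel_F_pos) auto

private lemma I_pos: "x > 0 \<Longrightarrow> I x > 0"
  unfolding I_def using \<nu> by (intro lommel_F_pos) auto

private lemma Lommel_t: "x > 0 \<Longrightarrow> modified_Lommel_t \<mu> \<nu> x = t x"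
  unfolding t_def a_def b_def by (rule modified_Lommel_t_eq)

private lemma Bessel_I: "x > 0 \<Longrightarrow> modified_Bessel_I \<nu> x = I x"
  unfolding I_def by (rule modified_Bessel_I_eq)

private lemma log_deriv_t: "log_deriv t (\<lambda>x. \<nu> / x + lommel_F (a - 1) b x / t x)"
proof -
  have "log_deriv t (\<lambda>x. (b - a) / x + lommel_F (a - 1) b x / t x)"
    unfolding t_def using ab by (intro log_deriv_lommel_F) auto
  thus ?thesis unfolding ab_eq(1) .
qed

private lemma log_deriv_I: "log_deriv I (\<lambda>x. \<nu> / x + lommel_F 1 (\<nu> + 2) x / I x)"
proof -
  have "log_deriv I (\<lambda>x. (\<nu> + 1 - 1) / x + lommel_F (1 - 1) (\<nu> + 1) x / I x)"
    unfolding I_def using \<nu> by (intro log_deriv_lommel_F) auto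
  thus ?thesis by (simp add: log_deriv_def lommel_F_0_left add.assoc)
qed

private lemma log_deriv_H:
  "log_deriv H (\<lambda>x. - ((\<mu> - \<nu> + 1) / 2) * (2 * (1 / x) - 2 * x / (A + x\<^sup>2))
      + (\<nu> / x + lommel_F (a - 1) b x / t x) - (\<nu> / x + lommel_F 1 (\<nu> + 2) x / I x))"
proof -
  have "log_deriv (\<lambda>x. x\<^sup>2) (\<lambda>x. 2 * (1 / x))"
    unfolding log_deriv_def by (auto intro!: derivative_eq_intros simp: power2_eq_square)
  note 1 = log_deriv_divide[OF this log_deriv_add_power2[OF A(2)]]
  note 2 = log_deriv_powr[OF 1, of "- ((\<mu> - \<nu> + 1) / 2)"]
  note 3 = log_deriv_mult[OF 2 log_deriv_t]
  show ?thesis unfolding H_def by (rule log_deriv_divide[OF 3 log_deriv_I])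
qed

private lemma H_decreasing:
  assumes "0 < x" "x < y"
  shows "H y < H x"
proof (rule log_deriv_decreasing[OF log_deriv_H _ assms])
  fix x :: real assume x: "x > 0"
  have pos: "A + x\<^sup>2 > 0" using A by (simp add: add_pos_nonneg)
  \<comment> \<open>The power in \<open>H\<close> is chosen so that its logarithmic derivative is
    exactly minus the two-term bound for the first term.\<close>
  have "(\<mu> - \<nu> + 1) / 2 * (2 * (1 / x) - 2 * x / (A + x\<^sup>2)) = (\<mu> - \<nu> + 1) / x * (A / (A + x\<^sup>2))"
    using x pos by (simp add: divide_simps) (simp add: algebra_simps power2_eq_square)
  moreover have "lommel_F (a - 1) b x / t x < lommel_F 1 (\<nu> + 2) x / I x + (\<mu> - \<nu> + 1) / x * (A / (A + x\<^sup>2))"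
    using lommel_log_deriv_less[OF ab(1,2) x] unfolding A(1) ab_eq t_def I_def .
  ultimately show "- ((\<mu> - \<nu> + 1) / 2) * (2 * (1 / x) - 2 * x / (A + x\<^sup>2))
      + (\<nu> / x + lommel_F (a - 1) b x / t x) - (\<nu> / x + lommel_F 1 (\<nu> + 2) x / I x) < 0"
    by simp
qed

private lemma H_pos: "x > 0 \<Longrightarrow> H x > 0"
  using log_deriv_H by (rule log_deriv_pos)

private lemma L_powr:
  assumes "x > 0"
  shows "(x\<^sup>2 / (A + x\<^sup>2)) powr (- c) = (A + x\<^sup>2) powr c * x powr (- (2 * c))"
proof -
  have "A + x\<^sup>2 > 0" using A by (simp add: add_pos_nonneg)
  moreover have "(x\<^sup>2) powr (- c) = x powr (- (2 * c))"
    using assms by (simp add: powr_powr flip: powr_numeral)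
  moreover have "(x\<^sup>2 / (A + x\<^sup>2)) powr (- c) = (x\<^sup>2) powr (- c) / (A + x\<^sup>2) powr (- c)"
    by (rule powr_divide)
  ultimately show ?thesis by (simp add: powr_minus divide_inverse)
qed

private lemma one_less_H:
  assumes "\<nu> > -1" "x > 0"
  shows "1 < H x"
proof (rule decreasing_gt_limit[OF H_decreasing _ assms(2)])
  have "((\<lambda>x. x\<^sup>2 / (A + x\<^sup>2)) \<longlongrightarrow> 1) at_top" by real_asymp
  hence "((\<lambda>x. (x\<^sup>2 / (A + x\<^sup>2)) powr (- ((\<mu> - \<nu> + 1) / 2)) * (t x / I x)) \<longlongrightarrow> 1 powr (- ((\<mu> - \<nu> + 1) / 2)) * 1) at_top"
    unfolding t_def I_def using assms(1) ab by (intro tendsto_intros lommel_F_div_tendsto) auto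
  thus "(H \<longlongrightarrow> 1) at_top" by (simp add: H_def)
qed

private lemma lommel_F_tendsto_scaled:
  "((\<lambda>x. x powr (- (c + d - 2)) * lommel_F c d x) \<longlongrightarrow> 2 powr (- (c + d - 2)) * (rGamma c * rGamma d)) (at_right 0)"
proof (rule Lim_transform_eventually)
  show "((\<lambda>x. 2 powr (- (c + d - 2)) * lommel_G c d ((x / 2)\<^sup>2)) \<longlongrightarrow> 2 powr (- (c + d - 2)) * (rGamma c * rGamma d)) (at_right 0)"
    by (intro tendsto_intros lommel_G_tendsto)
  have "eventually (\<lambda>x::real. x > 0) (at_right 0)" by real_asymp
  thus "eventually (\<lambda>x. 2 powr (- (c + d - 2)) * lommel_G c d ((x / 2)\<^sup>2) = x powr (- (c + d - 2)) * lommel_F c d x) (at_right 0)"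
  proof eventually_elim
    case (elim x)
    have "x powr (- (c + d - 2)) * (x / 2) powr (c + d - 2) = 2 powr (- (c + d - 2))"
      using elim by (simp only: powr_minus) (simp add: powr_divide inverse_eq_divide)
    thus ?case by (simp add: lommel_F_def flip: mult.assoc)
  qed
qed

private lemma H_less:
  assumes "\<nu> > -1" "x > 0"
  shows "H x < Lommel_C \<mu> \<nu>"
proof (rule decreasing_less_limit[OF H_decreasing _ assms(2)])
  \<comment> \<open>Here \<nu> > -1 enters: 1/\<Gamma>(\<nu> + 1) is a factor of the limit of the
    denominator.\<close>
  have rI: "rGamma 1 * rGamma (\<nu> + 1) \<noteq> 0" using assms rGamma_pos_real[of "\<nu> + 1"] by simp
  have P: "2 powr (- (a + b - 2)) = 2 powr (- (\<mu> - \<nu> + 1)) * 2 powr (- (1 + (\<nu> + 1) - 2))"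
  proof -
    have "- (a + b - 2) = - (\<mu> - \<nu> + 1) + - (1 + (\<nu> + 1) - 2)" using ab_eq(4) by simp
    thus ?thesis by (simp only: powr_add)
  qed
  have eq: "(A + 0\<^sup>2) powr ((\<mu> - \<nu> + 1) / 2) *
         ((2 powr (- (a + b - 2)) * (rGamma a * rGamma b)) / (2 powr (- (1 + (\<nu> + 1) - 2)) * (rGamma 1 * rGamma (\<nu> + 1))))
       = Lommel_C \<mu> \<nu>"
  proof -
    have alg: "X * ((1 / p * q * (inverse ga * inverse gb)) / (q * (1 * inverse gn))) = X * gn / (p * ga * gb)"
      if "q > 0" "p > 0" "ga > 0" "gb > 0" "gn > 0" for X p q ga gb gn :: real
      using that by (simp add: field_simps)
    have "A + 0\<^sup>2 = A" by simp
    note eqs = this rGamma_1 rGamma_inverse_Gamma[of a] rGamma_inverse_Gamma[of b]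
      rGamma_inverse_Gamma[of "\<nu> + 1"] powr_minus_divide[of 2 "\<mu> - \<nu> + 1"]
    show ?thesis
      unfolding P Lommel_C_def A_def[symmetric] a_def[symmetric] b_def[symmetric] eqs
      by (rule alg) (use ab(1,3) assms(1) in simp_all)
  qed
  have lim: "((\<lambda>x. (A + x\<^sup>2) powr ((\<mu> - \<nu> + 1) / 2) * ((x powr (- (a + b - 2)) * t x) / (x powr (- (1 + (\<nu> + 1) - 2)) * I x)))
     \<longlongrightarrow> Lommel_C \<mu> \<nu>) (at_right 0)"
    unfolding eq[symmetric] t_def I_def using A(2) rI
    by (intro tendsto_mult tendsto_divide lommel_F_tendsto_scaled tendsto_powr tendsto_add tendsto_power tendsto_const tendsto_ident_at) auto
  have "eventually (\<lambda>x::real. x > 0) (at_right 0)" by real_asymp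
  hence "eventually (\<lambda>x. (A + x\<^sup>2) powr ((\<mu> - \<nu> + 1) / 2) * ((x powr (- (a + b - 2)) * t x) / (x powr (- (1 + (\<nu> + 1) - 2)) * I x)) = H x) (at_right 0)"
  proof eventually_elim
    case (elim x)
    have "x powr (- (a + b - 2)) = x powr (- (2 * ((\<mu> - \<nu> + 1) / 2))) * x powr (- (1 + (\<nu> + 1) - 2))"
    proof -
      have "- (a + b - 2) = - (2 * ((\<mu> - \<nu> + 1) / 2)) + - (1 + (\<nu> + 1) - 2)" using ab_eq(4) by (simp add: field_simps)
      thus ?thesis by (simp only: powr_add)
    qed
    moreover have "x powr (- (1 + (\<nu> + 1) - 2)) > 0" using elim by simp
    ultimately show ?case unfolding H_def L_powr[OF elim] by simp
  qed
  with lim show "(H \<longlongrightarrow> Lommel_C \<mu> \<nu>) (at_right 0)" by (rule Lim_transform_eventually)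
qed

lemma lommel_Bessel_quotient_lower:
  assumes "0 < x" "x < y"
  shows "(x / y) powr (\<mu> - \<nu> + 1) *
      (((\<mu> + 3)\<^sup>2 - \<nu>\<^sup>2 + y\<^sup>2) / ((\<mu> + 3)\<^sup>2 - \<nu>\<^sup>2 + x\<^sup>2)) powr ((\<mu> - \<nu> + 1) / 2) *
      (modified_Bessel_I \<nu> x / modified_Bessel_I \<nu> y)
      < modified_Lommel_t \<mu> \<nu> x / modified_Lommel_t \<mu> \<nu> y"
proof -
  have y: "y > 0" using assms by simp
  define d where "d = (\<mu> - \<nu> + 1) / 2"
  have d2: "\<mu> - \<nu> + 1 = 2 * d" by (simp add: d_def)
  have pos: "A + x\<^sup>2 > 0" "A + y\<^sup>2 > 0" using A by (simp_all add: add_pos_nonneg)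
  have "H y < H x" using assms by (rule H_decreasing)
  hence "(A + y\<^sup>2) powr d * y powr (- (2 * d)) * t y / I y < (A + x\<^sup>2) powr d * x powr (- (2 * d)) * t x / I x"
    unfolding H_def d_def[symmetric] L_powr[OF assms(1)] L_powr[OF y] .
  hence "(x powr (2 * d) / y powr (2 * d)) * ((A + y\<^sup>2) powr d / (A + x\<^sup>2) powr d) * (I x / I y) < t x / t y"
    using pos t_pos[OF y] I_pos[OF y] I_pos[OF assms(1)] assms(1) y
    by (simp add: powr_minus field_simps)
  thus ?thesis
    unfolding Lommel_t[OF y] Lommel_t[OF assms(1)] Bessel_I[OF y] Bessel_I[OF assms(1)] A_def[symmetric] d2
    using assms(1) y pos by (simp add: powr_divide)
qed

lemma Bessel_less_lommel:
  assumes "\<nu> > -1" "x > 0"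
  shows "modified_Bessel_I \<nu> x <
      (x\<^sup>2 / ((\<mu> + 3)\<^sup>2 - \<nu>\<^sup>2 + x\<^sup>2)) powr (- ((\<mu> - \<nu> + 1) / 2)) * modified_Lommel_t \<mu> \<nu> x"
  using one_less_H[OF assms] I_pos[OF assms(2)]
  unfolding Lommel_t[OF assms(2)] Bessel_I[OF assms(2)] A_def[symmetric] H_def
  by (simp add: less_divide_eq)

lemma lommel_less_Bessel:
  assumes "\<nu> > -1" "x > 0"
  shows "(x\<^sup>2 / ((\<mu> + 3)\<^sup>2 - \<nu>\<^sup>2 + x\<^sup>2)) powr (- ((\<mu> - \<nu> + 1) / 2)) * modified_Lommel_t \<mu> \<nu> x
      < Lommel_C \<mu> \<nu> * modified_Bessel_I \<nu> x"
  using H_less[OF assms] I_pos[OF assms(2)]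
  unfolding Lommel_t[OF assms(2)] Bessel_I[OF assms(2)] A_def[symmetric] H_def
  by (simp add: divide_less_eq)

private lemma I_div_t_decreasing:
  assumes b1: "b > 1" and "0 < x" "x < y"
  shows "I y / t y < I x / t x"
proof (rule log_deriv_decreasing[OF log_deriv_divide[OF log_deriv_I log_deriv_t] _ assms(2,3)])
  fix x :: real assume x: "x > 0"
  show "\<nu> / x + lommel_F 1 (\<nu> + 2) x / I x - (\<nu> / x + lommel_F (a - 1) b x / t x) < 0"
    using Bessel_ratio_less_lommel_ratio[OF ab(1) b1 ab(2) x] t_pos[OF x] I_pos[OF x]
    unfolding ab_eq t_def I_def by (simp add: field_simps)
qed

lemma lommel_Bessel_quotient_upper:
  assumes "\<mu> + \<nu> > -1" "0 < x" "x < y"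
  shows "modified_Lommel_t \<mu> \<nu> x / modified_Lommel_t \<mu> \<nu> y < modified_Bessel_I \<nu> x / modified_Bessel_I \<nu> y"
proof -
  have y: "y > 0" using assms by simp
  have "b > 1" using assms(1) by (simp add: b_def)
  from ratio_less_cross[OF I_div_t_decreasing[OF this assms(2,3)]] show ?thesis
    using t_pos[OF y] I_pos[OF y] t_pos[OF assms(2)] I_pos[OF assms(2)]
    unfolding Lommel_t[OF y] Lommel_t[OF assms(2)] Bessel_I[OF y] Bessel_I[OF assms(2)]
    by (simp add: field_simps)
qed

lemma lommel_less_Bessel_unscaled:
  assumes "\<mu> + \<nu> > -1" "\<nu> > -1" "x > 0"
  shows "modified_Lommel_t \<mu> \<nu> x < modified_Bessel_I \<nu> x"
proof -
  have "b > 1" using assms(1) by (simp add: b_def)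
  have "((\<lambda>x. I x / t x) \<longlongrightarrow> 1) at_top"
    unfolding I_def t_def using ab assms(2) by (intro lommel_F_div_tendsto) auto
  from decreasing_gt_limit[OF I_div_t_decreasing[OF \<open>b > 1\<close>] this assms(3)]
  show ?thesis
    using t_pos[OF assms(3)] unfolding Lommel_t[OF assms(3)] Bessel_I[OF assms(3)]
    by (simp add: less_divide_eq)
qed

section \<open>Explicit bounds with square roots\<close>

context
  fixes B :: real
  assumes \<nu>_half: "-1/2 \<le> \<nu>"
  defines "B \<equiv> \<nu> + 1 / 2"
begin

private definition S where "S = (\<lambda>x. exp (sqrt (B\<^sup>2 + x\<^sup>2)) * (B + sqrt (B\<^sup>2 + x\<^sup>2)) powr (- B))"
text \<open>The denominator has logarithmic derivative \<nu>/x + x/(B + sqrt(B^2 + x^2)), the upper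
  bound for I'/I from \<open>Bessel_ratio_le\<close>; hence \<open>J\<close> does not
  increase.\<close>

private definition J where "J = (\<lambda>x. I x / (S x * x powr \<nu>))"

private lemma B: "B \<ge> 0"
  using \<nu>_half by (simp add: B_def)

private lemma s_pos:
  assumes "x > 0"
  shows "sqrt (B\<^sup>2 + x\<^sup>2) > 0" "B + sqrt (B\<^sup>2 + x\<^sup>2) > 0"
proof -
  show "sqrt (B\<^sup>2 + x\<^sup>2) > 0" using assms by (simp add: add_nonneg_pos)
  thus "B + sqrt (B\<^sup>2 + x\<^sup>2) > 0" using B by linarith
qed

private lemma log_deriv_J:
  "log_deriv J (\<lambda>x. \<nu> / x + lommel_F 1 (\<nu> + 2) x / I x - (x / (B + sqrt (B\<^sup>2 + x\<^sup>2)) + \<nu> * (1 / x)))"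
  unfolding J_def S_def
  by (rule log_deriv_divide[OF log_deriv_I
        log_deriv_mult[OF log_deriv_exp_sqrt_powr[OF B] log_deriv_powr[OF log_deriv_ident]]])

private lemma J_nonincreasing:
  assumes "0 < x" "x \<le> y"
  shows "J y \<le> J x"
proof (rule log_deriv_nonincreasing[OF log_deriv_J _ assms])
  fix x :: real assume x: "x > 0"
  have "lommel_F 1 (\<nu> + 2) x / I x \<le> x / (B + sqrt (B\<^sup>2 + x\<^sup>2))"
    using Bessel_ratio_le[of \<nu> x] \<nu>_half x I_pos[OF x] unfolding I_def B_def
    by (simp add: pos_divide_le_eq)
  thus "\<nu> / x + lommel_F 1 (\<nu> + 2) x / I x - (x / (B + sqrt (B\<^sup>2 + x\<^sup>2)) + \<nu> * (1 / x)) \<le> 0" by simp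
qed

private lemma J_pos: "x > 0 \<Longrightarrow> J x > 0"
  using log_deriv_J by (rule log_deriv_pos)

private lemma J_ge:
  assumes "x > 0"
  shows "1 / sqrt (2 * pi) \<le> J x"
proof (rule nonincreasing_ge_limit[OF J_nonincreasing _ assms])
  have "((\<lambda>x. exp (x - sqrt (B\<^sup>2 + x\<^sup>2))) \<longlongrightarrow> 1) at_top" by real_asymp
  moreover have "((\<lambda>x. (B + sqrt (B\<^sup>2 + x\<^sup>2)) / x) \<longlongrightarrow> 1) at_top" by real_asymp
  hence "((\<lambda>x. ((B + sqrt (B\<^sup>2 + x\<^sup>2)) / x) powr B) \<longlongrightarrow> 1 powr B) at_top"
    by (intro tendsto_intros) auto
  moreover have "((\<lambda>x. I x * sqrt x * exp (- x)) \<longlongrightarrow> 1 / sqrt (2 * pi)) at_top"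
    unfolding I_def using \<nu>_half by (intro lommel_F_sqrt_exp_tendsto) auto
  ultimately have "((\<lambda>x. (I x * sqrt x * exp (- x)) * exp (x - sqrt (B\<^sup>2 + x\<^sup>2)) * ((B + sqrt (B\<^sup>2 + x\<^sup>2)) / x) powr B)
       \<longlongrightarrow> 1 / sqrt (2 * pi) * 1 * 1 powr B) at_top"
    by (intro tendsto_mult)
  moreover have "eventually (\<lambda>x. (I x * sqrt x * exp (- x)) * exp (x - sqrt (B\<^sup>2 + x\<^sup>2)) * ((B + sqrt (B\<^sup>2 + x\<^sup>2)) / x) powr B = J x) at_top"
    using eventually_gt_at_top[of 0]
  proof eventually_elim
    case (elim x)
    \<comment> \<open>This is why the exponent is \<nu> + 1/2: the factor x powr \<nu> in
      \<open>J\<close> and the sqrt x of the asymptotics together balance (B + s) powr B, with s the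
      square root.\<close>
    have "x powr B = x powr \<nu> * sqrt x"
      unfolding B_def powr_add using elim by (simp add: powr_half_sqrt)
    thus ?case
      unfolding J_def S_def using elim s_pos(2)[OF elim]
      by (simp add: powr_divide powr_minus exp_minus exp_diff field_simps)
  qed
  ultimately show "(J \<longlongrightarrow> 1 / sqrt (2 * pi)) at_top" by (auto intro: Lim_transform_eventually)
qed simp_all

private definition Z where
  "Z = (\<lambda>x. ((A + x\<^sup>2) powr ((\<mu> - \<nu> + 1) / 2) * (B + sqrt (B\<^sup>2 + x\<^sup>2)) powr B / (x powr (\<mu> + 1) * exp (sqrt (B\<^sup>2 + x\<^sup>2)))) * t x)"

text \<open>The Bessel function cancels between \<open>H\<close> and \<open>J\<close>. Strict
  monotonicity of \<open>Z\<close> then comes from \<open>H\<close>, while the weak one of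
  \<open>J\<close> suffices.\<close>

private lemma Z_eq:
  assumes "x > 0"
  shows "Z x = H x * J x"
proof -
  have "x powr (\<mu> + 1) = x powr (2 * ((\<mu> - \<nu> + 1) / 2)) * x powr \<nu>"
  proof -
    have "\<mu> + 1 = 2 * ((\<mu> - \<nu> + 1) / 2) + \<nu>" by (simp add: field_simps)
    thus ?thesis by (simp only: powr_add)
  qed
  moreover have "P * Q / ((X * N) * E) * T = (P * inverse X) * T / i * (i / ((E * inverse Q) * N))"
    if "i > 0" for P Q X N E T i :: real
    using that by (simp add: divide_inverse mult_ac)
  ultimately show ?thesis
    using I_pos[OF assms] unfolding Z_def H_def J_def S_def L_powr[OF assms]
    unfolding powr_minus by (simp only:)
qed

private lemma Z_decreasing:
  assumes "0 < x" "x < y"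
  shows "Z y < Z x"
proof -
  have y: "y > 0" using assms by simp
  have "H y * J y < H x * J y" using H_decreasing[OF assms] J_pos[OF y] by simp
  also have "\<dots> \<le> H x * J x" using J_nonincreasing[of x y] H_pos[of x] assms by simp
  finally show ?thesis using assms(1) y by (simp add: Z_eq)
qed

private lemma Z_tendsto: "(Z \<longlongrightarrow> Lommel_C' \<mu> \<nu>) (at_right 0)"
proof (rule Lim_transform_eventually)
  \<comment> \<open>As x tends to 0, B + sqrt(B^2 + x^2) becomes 2B and the exponential e^B, which
    matches (e^(-1) (2\<nu> + 1))^(\<nu> + 1/2). At \<nu> = -1/2 both sides are 1 by the convention
    0^0 = 1.\<close>
  have rp: "rpow (exp (- 1) * (2 * \<nu> + 1)) (\<nu> + 1 / 2) = rpow (B + B) B / exp B"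
  proof (cases "B = 0")
    case False
    hence "exp (- 1) powr B * (2 * B) powr B = (2 * B) powr B / exp B"
    proof -
      have "exp (- 1) powr B = exp (- B)" by (simp add: powr_def)
      thus ?thesis by (simp add: exp_minus divide_inverse)
    qed
    hence "rpow (exp (- 1) * (2 * B)) B = rpow (B + B) B / exp B"
      using False B by (simp add: rpow_def powr_mult)
    moreover have "2 * \<nu> + 1 = 2 * B" "\<nu> + 1 / 2 = B" by (simp_all add: B_def)
    ultimately show ?thesis by (simp only:)
  qed (auto simp: rpow_def B_def)
  have eq: "(A + 0\<^sup>2) powr ((\<mu> - \<nu> + 1) / 2) * rpow (B + B) B / exp B * (2 powr (- (a + b - 2)) * (rGamma a * rGamma b)) = Lommel_C' \<mu> \<nu>"
  proof -
    have alg: "X * r / e * (1 / p * (inverse ga * inverse gb)) = X * (r / e) / (p * ga * gb)"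
      for X r e p ga gb :: real
      by (simp add: divide_inverse mult_ac)
    have "A + 0\<^sup>2 = A" "a + b - 2 = \<mu> + 1" using ab_eq(4) by simp_all
    note eqs = this rGamma_inverse_Gamma[of a] rGamma_inverse_Gamma[of b] powr_minus_divide[of 2 "\<mu> + 1"]
    show ?thesis
      unfolding Lommel_C'_def A_def[symmetric] a_def[symmetric] b_def[symmetric] rp eqs by (rule alg)
  qed
  show "((\<lambda>x. (A + x\<^sup>2) powr ((\<mu> - \<nu> + 1) / 2) * (B + sqrt (B\<^sup>2 + x\<^sup>2)) powr B / exp (sqrt (B\<^sup>2 + x\<^sup>2)) * (x powr (- (a + b - 2)) * t x))
     \<longlongrightarrow> Lommel_C' \<mu> \<nu>) (at_right 0)"
    unfolding eq[symmetric] t_def using A(2) B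
    by (intro tendsto_mult tendsto_divide lommel_F_tendsto_scaled tendsto_exp sqrt_sq_add_tendsto powr_add_sqrt_tendsto
          tendsto_powr tendsto_add tendsto_power tendsto_const tendsto_ident_at) auto
  show "eventually (\<lambda>x. (A + x\<^sup>2) powr ((\<mu> - \<nu> + 1) / 2) * (B + sqrt (B\<^sup>2 + x\<^sup>2)) powr B / exp (sqrt (B\<^sup>2 + x\<^sup>2)) * (x powr (- (a + b - 2)) * t x) = Z x) (at_right 0)"
  proof (intro always_eventually allI)
    fix x
    have "a + b - 2 = \<mu> + 1" using ab_eq(4) by simp
    thus "(A + x\<^sup>2) powr ((\<mu> - \<nu> + 1) / 2) * (B + sqrt (B\<^sup>2 + x\<^sup>2)) powr B / exp (sqrt (B\<^sup>2 + x\<^sup>2)) * (x powr (- (a + b - 2)) * t x) = Z x"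
      by (simp only: Z_def powr_minus divide_inverse inverse_mult_distrib mult_ac)
  qed
qed

lemma lommel_quotient_lower:
  assumes "0 < x" "x < y"
  shows "exp (sqrt ((\<nu> + 1/2)\<^sup>2 + x\<^sup>2)) / exp (sqrt ((\<nu> + 1/2)\<^sup>2 + y\<^sup>2)) *
      (x / y) powr (\<mu> + 1) *
      (((\<mu> + 3)\<^sup>2 - \<nu>\<^sup>2 + y\<^sup>2) / ((\<mu> + 3)\<^sup>2 - \<nu>\<^sup>2 + x\<^sup>2)) powr ((\<mu> - \<nu> + 1) / 2) *
      ((\<nu> + 1/2 + sqrt ((\<nu> + 1/2)\<^sup>2 + y\<^sup>2)) /
       (\<nu> + 1/2 + sqrt ((\<nu> + 1/2)\<^sup>2 + x\<^sup>2))) powr (\<nu> + 1/2)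
    < modified_Lommel_t \<mu> \<nu> x / modified_Lommel_t \<mu> \<nu> y"
proof -
  have y: "y > 0" using assms by simp
  have pos: "A + x\<^sup>2 > 0" "A + y\<^sup>2 > 0" using A by (simp_all add: add_pos_nonneg)
  note s = s_pos(2)[OF assms(1)] s_pos(2)[OF y]
  \<comment> \<open>\<open>Z\<close> without its factor t, so that quotients of \<open>W\<close> are
    the explicit bound.\<close>
  define W where "W = (\<lambda>x. (A + x\<^sup>2) powr ((\<mu> - \<nu> + 1) / 2) * (B + sqrt (B\<^sup>2 + x\<^sup>2)) powr B / (x powr (\<mu> + 1) * exp (sqrt (B\<^sup>2 + x\<^sup>2))))"
  have W: "W x > 0" using pos s assms(1) by (simp add: W_def)
  have "W y * t y < W x * t x" using Z_decreasing[OF assms] unfolding Z_def W_def .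
  hence "W y / W x < t x / t y" using W t_pos[OF y] by (simp add: field_simps)
  also have "W y / W x = exp (sqrt (B\<^sup>2 + x\<^sup>2)) / exp (sqrt (B\<^sup>2 + y\<^sup>2)) * (x / y) powr (\<mu> + 1) *
      ((A + y\<^sup>2) / (A + x\<^sup>2)) powr ((\<mu> - \<nu> + 1) / 2) *
      ((B + sqrt (B\<^sup>2 + y\<^sup>2)) / (B + sqrt (B\<^sup>2 + x\<^sup>2))) powr B"
    unfolding W_def using pos s assms(1) y by (simp add: powr_divide field_simps)
  finally show ?thesis
    unfolding Lommel_t[OF y] Lommel_t[OF assms(1)] A_def B_def .
qed

lemma lommel_lower:
  assumes "0 < x"
  shows "1 / sqrt (2 * pi) <
      ((\<mu> + 3)\<^sup>2 - \<nu>\<^sup>2 + x\<^sup>2) powr ((\<mu> - \<nu> + 1) / 2) *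
      (\<nu> + 1/2 + sqrt ((\<nu> + 1/2)\<^sup>2 + x\<^sup>2)) powr (\<nu> + 1/2) /
      (x powr (\<mu> + 1) * exp (sqrt ((\<nu> + 1/2)\<^sup>2 + x\<^sup>2))) * modified_Lommel_t \<mu> \<nu> x"
proof -
  have "1 / sqrt (2 * pi) \<le> 1 * J x" using J_ge[OF assms] by simp
  also have "\<dots> < H x * J x"
    using one_less_H[OF _ assms] \<nu>_half J_pos[OF assms] by (intro mult_strict_right_mono) auto
  also have "\<dots> = Z x" using Z_eq[OF assms] by simp
  finally show ?thesis unfolding Z_def Lommel_t[OF assms] A_def B_def .
qed

lemma lommel_upper:
  assumes "0 < x"
  shows "((\<mu> + 3)\<^sup>2 - \<nu>\<^sup>2 + x\<^sup>2) powr ((\<mu> - \<nu> + 1) / 2) *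
      (\<nu> + 1/2 + sqrt ((\<nu> + 1/2)\<^sup>2 + x\<^sup>2)) powr (\<nu> + 1/2) /
      (x powr (\<mu> + 1) * exp (sqrt ((\<nu> + 1/2)\<^sup>2 + x\<^sup>2))) * modified_Lommel_t \<mu> \<nu> x
      < Lommel_C' \<mu> \<nu>"
  using decreasing_less_limit[OF Z_decreasing Z_tendsto assms]
  unfolding Z_def Lommel_t[OF assms] A_def B_def .

end

lemma lommel_quotient_upper:
  assumes \<mu>: "\<mu> \<ge> -1/2" and A6: "(\<mu> + 3)\<^sup>2 - \<nu>\<^sup>2 \<ge> 6" and "0 < x" "x < y"
  shows "modified_Lommel_t \<mu> \<nu> x / modified_Lommel_t \<mu> \<nu> y <
      exp (sqrt ((\<nu> + 3/2)\<^sup>2 + x\<^sup>2)) / exp (sqrt ((\<nu> + 3/2)\<^sup>2 + y\<^sup>2)) *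
      (tanh (x / 2) / tanh (y / 2)) powr (\<mu> - \<nu> + 1) *
      (x / y) powr \<nu> *
      ((\<mu> + 3/2 + sqrt ((\<nu> + 3/2)\<^sup>2 + y\<^sup>2)) /
       (\<mu> + 3/2 + sqrt ((\<nu> + 3/2)\<^sup>2 + x\<^sup>2))) powr (\<mu> + 3/2)"
proof -
  have y: "y > 0" using assms by simp
  define B where "B = \<mu> + 3 / 2"
  define K where "K = \<nu> + 3 / 2"
  have B: "B > 0" "B = a + b - 3 / 2" "K = b - a + 3 / 2" using \<mu> ab_eq by (auto simp: B_def K_def)
  \<comment> \<open>Its logarithmic derivative is a lower bound for t'/t: the Riccati subsolution,
    x/sinh x for the share of the first term, and \<nu>/x unchanged.\<close>
  define R where "R = (\<lambda>x. exp (sqrt (K\<^sup>2 + x\<^sup>2)) * (B + sqrt (K\<^sup>2 + x\<^sup>2)) powr (- B) * tanh (x / 2) powr (\<mu> - \<nu> + 1) * x powr \<nu>)"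
  have R: "log_deriv R (\<lambda>x. x / (B + sqrt (K\<^sup>2 + x\<^sup>2)) + (\<mu> - \<nu> + 1) * (1 / sinh x) + \<nu> * (1 / x))"
    unfolding R_def using B
    by (intro log_deriv_mult[OF log_deriv_mult[OF log_deriv_exp_sqrt_powr log_deriv_powr[OF log_deriv_tanh_half]]
          log_deriv_powr[OF log_deriv_ident]]) simp
  have "R y / t y < R x / t x"
  proof (rule log_deriv_decreasing[OF log_deriv_divide[OF R log_deriv_t] _ assms(3,4)])
    fix x :: real assume x: "x > 0"
    \<comment> \<open>The two hypotheses on \<mu> and \<nu> translated through a + b = \<mu> + 3 and
      4ab = (\<mu> + 3)^2 - \<nu>^2.\<close>
    have cond: "a + b \<ge> 5 / 2" "a * b \<ge> 3 / 2" using \<mu> ab_eq(4) A6 A(1) by (simp_all add: A_def)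
    have "x / (B + sqrt (K\<^sup>2 + x\<^sup>2)) < lommel_F a (b + 1) x / t x"
      using lommel_ratio_greater[OF ab(1,2) cond(1) x] t_pos[OF x] unfolding B(2,3) t_def
      by (simp add: pos_less_divide_eq)
    moreover have "x / sinh x \<le> lommel_term0 a b x / t x"
      using lommel_F_le_sinh[of a b x] ab cond x t_pos[OF x] unfolding t_def by (simp add: field_simps)
    hence "(\<mu> - \<nu> + 1) / x * (x / sinh x) \<le> (\<mu> - \<nu> + 1) / x * (lommel_term0 a b x / t x)"
      using \<nu> x by (intro mult_left_mono) auto
    moreover have "lommel_F (a - 1) b x / t x = lommel_F a (b + 1) x / t x + (\<mu> - \<nu> + 1) / x * (lommel_term0 a b x / t x)"
      unfolding lommel_F_eq_Suc[OF x] ab_eq by (simp add: add_divide_distrib)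
    ultimately show "x / (B + sqrt (K\<^sup>2 + x\<^sup>2)) + (\<mu> - \<nu> + 1) * (1 / sinh x) + \<nu> * (1 / x) - (\<nu> / x + lommel_F (a - 1) b x / t x) < 0"
      using x by simp
  qed
  hence "t x / t y < R x / R y"
    using t_pos[OF y] t_pos[OF assms(3)] log_deriv_pos[OF R y] log_deriv_pos[OF R assms(3)]
    by (simp add: field_simps)
  also have "R x / R y = exp (sqrt (K\<^sup>2 + x\<^sup>2)) / exp (sqrt (K\<^sup>2 + y\<^sup>2)) *
      (tanh (x / 2) / tanh (y / 2)) powr (\<mu> - \<nu> + 1) * (x / y) powr \<nu> *
      ((B + sqrt (K\<^sup>2 + y\<^sup>2)) / (B + sqrt (K\<^sup>2 + x\<^sup>2))) powr B"
  proof -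
    have "B + sqrt (K\<^sup>2 + x\<^sup>2) > 0" for x using B(1) by (simp add: add_pos_nonneg)
    note this[of x] this[of y]
    moreover have "tanh (x / 2) > 0" "tanh (y / 2) > 0" using y assms(3) by simp_all
    ultimately show ?thesis
      unfolding R_def using y assms(3) by (simp add: powr_divide powr_minus field_simps)
  qed
  finally show ?thesis unfolding Lommel_t[OF y] Lommel_t[OF assms(3)] B_def K_def .
qed

end

theorem theorem4p2:
  fixes \<mu> \<nu> :: real
  shows
   "(\<forall>x y. \<mu> > -2 \<and> -1 \<le> \<nu> \<and> \<nu> < \<mu> + 1 \<and> 0 < x \<and> x < y \<longrightarrow>
      (x / y) powr (\<mu> - \<nu> + 1) *
      (((\<mu> + 3)\<^sup>2 - \<nu>\<^sup>2 + y\<^sup>2) / ((\<mu> + 3)\<^sup>2 - \<nu>\<^sup>2 + x\<^sup>2)) powr ((\<mu> - \<nu> + 1) / 2) *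
      (modified_Bessel_I \<nu> x / modified_Bessel_I \<nu> y)
      < modified_Lommel_t \<mu> \<nu> x / modified_Lommel_t \<mu> \<nu> y) \<and>
    (\<forall>x y. \<mu> > -1 \<and> 0 \<le> \<nu> \<and> \<nu> < \<mu> + 1 \<and> 0 < x \<and> x < y \<longrightarrow>
      modified_Lommel_t \<mu> \<nu> x / modified_Lommel_t \<mu> \<nu> y
      < modified_Bessel_I \<nu> x / modified_Bessel_I \<nu> y) \<and>
    (\<forall>x y. \<mu> > -3/2 \<and> -1/2 \<le> \<nu> \<and> \<nu> < \<mu> + 1 \<and> 0 < x \<and> x < y \<longrightarrow>
      modified_Lommel_t \<mu> \<nu> x / modified_Lommel_t \<mu> \<nu> y >
      exp (sqrt ((\<nu> + 1/2)\<^sup>2 + x\<^sup>2)) / exp (sqrt ((\<nu> + 1/2)\<^sup>2 + y\<^sup>2)) *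
      (x / y) powr (\<mu> + 1) *
      (((\<mu> + 3)\<^sup>2 - \<nu>\<^sup>2 + y\<^sup>2) / ((\<mu> + 3)\<^sup>2 - \<nu>\<^sup>2 + x\<^sup>2)) powr ((\<mu> - \<nu> + 1) / 2) *
      ((\<nu> + 1/2 + sqrt ((\<nu> + 1/2)\<^sup>2 + y\<^sup>2)) /
       (\<nu> + 1/2 + sqrt ((\<nu> + 1/2)\<^sup>2 + x\<^sup>2))) powr (\<nu> + 1/2)) \<and>
    (\<forall>x y. \<mu> \<ge> -1/2 \<and> -1 \<le> \<nu> \<and> \<nu> < \<mu> + 1 \<and> (\<mu> + 3)\<^sup>2 - \<nu>\<^sup>2 \<ge> 6 \<and> 0 < x \<and> x < y \<longrightarrow>
      modified_Lommel_t \<mu> \<nu> x / modified_Lommel_t \<mu> \<nu> y <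
      exp (sqrt ((\<nu> + 3/2)\<^sup>2 + x\<^sup>2)) / exp (sqrt ((\<nu> + 3/2)\<^sup>2 + y\<^sup>2)) *
      (tanh (x / 2) / tanh (y / 2)) powr (\<mu> - \<nu> + 1) *
      (x / y) powr \<nu> *
      ((\<mu> + 3/2 + sqrt ((\<nu> + 3/2)\<^sup>2 + y\<^sup>2)) /
       (\<mu> + 3/2 + sqrt ((\<nu> + 3/2)\<^sup>2 + x\<^sup>2))) powr (\<mu> + 3/2)) \<and>
    (\<forall>x. \<mu> > -2 \<and> -1 < \<nu> \<and> \<nu> < \<mu> + 1 \<and> 0 < x \<longrightarrow>
      modified_Bessel_I \<nu> x <
      (x\<^sup>2 / ((\<mu> + 3)\<^sup>2 - \<nu>\<^sup>2 + x\<^sup>2)) powr (- ((\<mu> - \<nu> + 1) / 2)) * modified_Lommel_t \<mu> \<nu> x) \<and>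
    (\<forall>x. \<mu> > -2 \<and> -1 < \<nu> \<and> \<nu> < \<mu> + 1 \<and> 0 < x \<longrightarrow>
      (x\<^sup>2 / ((\<mu> + 3)\<^sup>2 - \<nu>\<^sup>2 + x\<^sup>2)) powr (- ((\<mu> - \<nu> + 1) / 2)) * modified_Lommel_t \<mu> \<nu> x
      < Lommel_C \<mu> \<nu> * modified_Bessel_I \<nu> x) \<and>
    (\<forall>x. \<mu> > -1 \<and> 0 \<le> \<nu> \<and> \<nu> < \<mu> + 1 \<and> 0 < x \<longrightarrow>
      modified_Lommel_t \<mu> \<nu> x < modified_Bessel_I \<nu> x) \<and>
    (\<forall>x. \<mu> > -3/2 \<and> -1/2 \<le> \<nu> \<and> \<nu> < \<mu> + 1 \<and> 0 < x \<longrightarrow>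
      1 / sqrt (2 * pi) <
      ((\<mu> + 3)\<^sup>2 - \<nu>\<^sup>2 + x\<^sup>2) powr ((\<mu> - \<nu> + 1) / 2) *
      (\<nu> + 1/2 + sqrt ((\<nu> + 1/2)\<^sup>2 + x\<^sup>2)) powr (\<nu> + 1/2) /
      (x powr (\<mu> + 1) * exp (sqrt ((\<nu> + 1/2)\<^sup>2 + x\<^sup>2))) * modified_Lommel_t \<mu> \<nu> x) \<and>
    (\<forall>x. \<mu> > -3/2 \<and> -1/2 \<le> \<nu> \<and> \<nu> < \<mu> + 1 \<and> 0 < x \<longrightarrow>
      ((\<mu> + 3)\<^sup>2 - \<nu>\<^sup>2 + x\<^sup>2) powr ((\<mu> - \<nu> + 1) / 2) *
      (\<nu> + 1/2 + sqrt ((\<nu> + 1/2)\<^sup>2 + x\<^sup>2)) powr (\<nu> + 1/2) /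
      (x powr (\<mu> + 1) * exp (sqrt ((\<nu> + 1/2)\<^sup>2 + x\<^sup>2))) * modified_Lommel_t \<mu> \<nu> x
      < Lommel_C' \<mu> \<nu>)"
proof (intro conjI allI impI, goal_cases)
  case (1 x y)
  thus ?case by (intro lommel_Bessel_quotient_lower) auto
next
  case (2 x y)
  thus ?case by (intro lommel_Bessel_quotient_upper) auto
next
  case (3 x y)
  thus ?case by (intro lommel_quotient_lower) auto
next
  case (4 x y)
  thus ?case by (intro lommel_quotient_upper) auto
next
  case (5 x)
  thus ?case by (intro Bessel_less_lommel) auto
next
  case (6 x)
  thus ?case by (intro lommel_less_Bessel) auto
next
  case (7 x)
  thus ?case by (intro lommel_less_Bessel_unscaled) auto
next
  case (8 x)
  thus ?case by (intro lommel_lower) auto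
next
  case (9 x)
  thus ?case by (intro lommel_upper) auto
qed

end
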